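(* Consider $\min_{\mathbf{x}\in\mathbb{R}^d}F(\mathbf{x})=f(\mathbf{x})+r(\mathbf{x})$ with $f(\mathbf{x})=\mathbb{E}_\xi[f(\mathbf{x};\xi)]$, where $r:\mathbb{R}^d\to\mathbb{R}\cup\{+\infty\}$ is proper and lower-semicontinuous (possibly non-smooth, non-convex). Assume: (i) $\mathbb{E}_\xi[\nabla f(\mathbf{x};\xi)]=\nabla f(\mathbf{x})$ and $\mathbb{E}_\xi[\|\nabla f(\mathbf{x};\xi)-\nabla f(\mathbf{x})\|^2]\le\sigma^2$ for all $\mathbf{x}$, for some $\sigma>0$; (ii) $F(\mathbf{x}_0)-F(\mathbf{x}_* )\le\Delta$ with $0<\Delta<\infty$ for the initial point $\mathbf{x}_0$, where $\mathbf{x}_*$ is a global minimizer of $F$; (iii) for some $L>0$, $f$ is differentiable with $\|\nabla f(\mathbf{x})-\nabla f(\mathbf{y})\|\le L\|\mathbf{x}-\mathbf{y}\|$ for all $\mathbf{x},\mathbf{y}$; (iv) with the same $L$, every $f(\cdot;\xi)$ is differentiable with $\|\nabla f(\mathbf{x};\xi)-\nabla f(\mathbf{y};\xi)\|\le L\|\mathbf{x}-\mathbf{y}\|$ for all $\mathbf{x},\mathbf{y}$. Let $\eta=\frac{c}{L}$ with $0<c<\frac13$, assume $\mathrm{prox}_{\eta r}[\mathbf{x}]\ne\emptyset$ for every $\mathbf{x}$, and put $\gamma=4L^2+\frac{1}{\eta^2}+\frac{2L}{\eta}$, $\theta=\frac{1-3\eta L}{2\eta}$. Let $\epsilon>0$.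 Then the output $\mathbf{x}_R$ of algorithm SPGR (defined in the context) satisfies $\mathbb{E}[\mathrm{dist}(0,\hat\partial F(\mathbf{x}_R))]\le\epsilon$ with the following parameter choices (non-integer values being rounded up to integers). - Online setting: $|\mathcal{S}_1|=\frac{(\gamma+4\theta L)\sigma^2}{\theta L\epsilon^2}$, $q=|\mathcal{S}_2|=\sqrt{|\mathcal{S}_1|}$, and $T=\frac{2(2\theta+\gamma\eta)\Delta}{\eta\theta\epsilon^2}$, giving a total complexity of $O(\epsilon^{-3})$. - Finite-sum setting: $|\mathcal{S}_1|=n$, $q=|\mathcal{S}_2|=\sqrt n$, and $T=\frac{(2\theta+\gamma\eta)\Delta}{\eta\theta\epsilon^2}$, giving a total complexity of $O(\sqrt n\,\epsilon^{-2}+n)$.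
   Context: Settings: in the finite-sum setting $f(\mathbf{x})=\frac1n\sum_{i=1}^nf_i(\mathbf{x})$, i.e. $\xi$ is uniform on $\{1,\dots,n\}$ and $f(\cdot;i)=f_i$; the online setting is the general expectation case. For a finite batch $\mathcal{S}$ of samples, $\nabla f_{\mathcal{S}}(\mathbf{x})=\frac{1}{|\mathcal{S}|}\sum_{\xi_i\in\mathcal{S}}\nabla f(\mathbf{x};\xi_i)$. Algorithm SPGR (stochastic proximal gradient with SPIDER/SARAH), with positive integer parameters $T,q,|\mathcal{S}_1|,|\mathcal{S}_2|$ and step size $\eta$: starting from $\mathbf{x}_0$, for $t=0,\dots,T-1$: if $q$ divides $t$, then in the online setting draw a fresh batch $\mathcal{S}_1$ of $|\mathcal{S}_1|$ i.i.d. samples and set $\mathbf{g}_t=\nabla f_{\mathcal{S}_1}(\mathbf{x}_t)$, while in the finite-sum setting $\mathcal{S}_1$ is the full data set ($|\mathcal{S}_1|=n$) so $\mathbf{g}_t=\nabla f(\mathbf{x}_t)$; otherwise draw a fresh batch $\mathcal{S}_2$ of $|\mathcal{S}_2|$ i.i.d. samples and set $\mathbf{g}_t=\nabla f_{\mathcal{S}_2}(\mathbf{x}_t)-\nabla f_{\mathcal{S}_2}(\mathbf{x}_{t-1})+\mathbf{g}_{t-1}$. Fresh batches are independent of the past. Then choose $\mathbf{x}_{t+1}\in\mathrm{prox}_{\eta r}[\mathbf{x}_t-\eta\mathbf{g}_t]$ (the iterates being random variables). Output $\mathbf{x}_R$ with $R$ uniform on $\{1,\dots,T\}$, independent of everything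 else. Total complexity means the number of samples processed, bounded by $|\mathcal{S}_2|T+|\mathcal{S}_1|\lceil T/q\rceil$ (equivalently, up to a constant factor, the number of stochastic gradients computed). Constants in $O(\cdot)$ depend on $c,L,\Delta$ and (online setting) $\sigma$, but not on $\epsilon$ or $n$; the online bound is as $\epsilon\to0$. $\|\cdot\|$ is the Euclidean norm; $\mathrm{prox}_{\eta r}[\mathbf{x}]=\arg\min_{\mathbf{y}\in\mathbb{R}^d}\frac{1}{2\eta}\|\mathbf{y}-\mathbf{x}\|^2+r(\mathbf{y})$ (set of minimizers). For $h:\mathbb{R}^d\to\mathbb{R}\cup\{+\infty\}$ and $\bar{\mathbf{x}}$ with $h(\bar{\mathbf{x}})$ finite, the Fréchet subgradient set is $\hat\partial h(\bar{\mathbf{x}})=\{\mathbf{v}\in\mathbb{R}^d:\liminf_{\mathbf{x}\to\bar{\mathbf{x}},\,\mathbf{x}\ne\bar{\mathbf{x}}}\frac{h(\mathbf{x})-h(\bar{\mathbf{x}})-\mathbf{v}^\top(\mathbf{x}-\bar{\mathbf{x}})}{\|\mathbf{x}-\bar{\mathbf{x}}\|}\ge0\}$. $\mathrm{dist}(0,S)=\inf_{\mathbf{v}\in S}\|\mathbf{v}\|$ (and $+\infty$ if $S=\emptyset$). *)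

theory Defs
  imports "HOL-Probability.Probability" "HOL-Library.Landau_Symbols"
begin

section \<open>Variational analysis\<close>

definition gradient :: "('a::real_inner \<Rightarrow> real) \<Rightarrow> 'a \<Rightarrow> 'a" where
  "gradient h x = (THE v. GDERIV h x :> v)"

definition proper_fun :: "('a \<Rightarrow> ereal) \<Rightarrow> bool" where
  "proper_fun h \<longleftrightarrow> (\<forall>x. h x \<noteq> -\<infinity>) \<and> (\<exists>x. h x \<noteq> \<infinity>)"

definition lower_semicontinuous :: "('a::topological_space \<Rightarrow> ereal) \<Rightarrow> bool" where
  "lower_semicontinuous h \<longleftrightarrow> (\<forall>x. h x \<le> Liminf (at x) h)"

text \<open>Empty where the function is not finite.\<close>
definition frechet_subdiff :: "('a::real_inner \<Rightarrow> ereal) \<Rightarrow> 'a \<Rightarrow> 'a set" where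
  "frechet_subdiff h z =
     (if \<bar>h z\<bar> = \<infinity> then {}
      else {v. 0 \<le> Liminf (at z) (\<lambda>x. (h x - h z - ereal (v \<bullet> (x - z))) / ereal (norm (x - z)))})"

text \<open>The distance from 0 to a set. Unlike \<^const>\<open>infdist\<close>, it is infinite for the empty set.\<close>
definition dist_zero :: "'a::real_normed_vector set \<Rightarrow> ennreal" where
  "dist_zero S = (INF v\<in>S. ennreal (norm v))"

definition prox :: "real \<Rightarrow> ('a::real_normed_vector \<Rightarrow> ereal) \<Rightarrow> 'a \<Rightarrow> 'a set" where
  "prox \<eta> r x = {y. is_arg_min (\<lambda>y. ereal (1 / (2 * \<eta>) * (norm (y - x))\<^sup>2) + r y) (\<lambda>_. True) y}"

section \<open>The optimization problem\<close>

text \<open>The loss of the point \<open>x\<close> on the sample \<open>s\<close> is \<open>f x s\<close>, and \<open>D\<close> is the law of a sample.\<close>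

definition expected_loss :: "'s measure \<Rightarrow> ('a \<Rightarrow> 's \<Rightarrow> real) \<Rightarrow> 'a \<Rightarrow> real" where
  "expected_loss D f x = (\<integral>s. f x s \<partial>D)"

definition sample_gradient :: "('a::real_inner \<Rightarrow> 's \<Rightarrow> real) \<Rightarrow> 's \<Rightarrow> 'a \<Rightarrow> 'a" where
  "sample_gradient f s = gradient (\<lambda>y. f y s)"

definition objective :: "'s measure \<Rightarrow> ('a \<Rightarrow> 's \<Rightarrow> real) \<Rightarrow> ('a \<Rightarrow> ereal) \<Rightarrow> 'a \<Rightarrow> ereal" where
  "objective D f r x = ereal (expected_loss D f x) + r x"

locale composite_problem = prob_space D
  for D :: "'s measure" +
  fixes f :: "real ^ 'd \<Rightarrow> 's \<Rightarrow> real"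
    and r :: "real ^ 'd \<Rightarrow> ereal"
    and x0 :: "real ^ 'd"
    and L \<sigma> \<Delta> :: real
  assumes r_proper: "proper_fun r"
    and r_lsc: "lower_semicontinuous r"
    and loss_integrable: "\<And>x. integrable D (f x)"
    and gradient_integrable: "\<And>x. integrable D (\<lambda>s. sample_gradient f s x)"
    and gradient_unbiased:
      "\<And>x. (\<integral>s. sample_gradient f s x \<partial>D) = gradient (expected_loss D f) x"
    and \<sigma>_pos: "\<sigma> > 0"
    and gradient_variance:
      "\<And>x. (\<integral>\<^sup>+s. ennreal ((norm (sample_gradient f s x - gradient (expected_loss D f) x))\<^sup>2) \<partial>D)
              \<le> ennreal (\<sigma>\<^sup>2)"
    and \<Delta>_pos: "\<Delta> > 0"
    and initial_gap:
      "\<exists>x_star. is_arg_min (objective D f r) (\<lambda>_. True) x_star \<and>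
                objective D f r x0 - objective D f r x_star \<le> ereal \<Delta>"
    and L_pos: "L > 0"
    and loss_differentiable: "\<And>x. expected_loss D f differentiable (at x)"
    and loss_smooth: "L-lipschitz_on UNIV (gradient (expected_loss D f))"
    and sample_differentiable: "\<And>s x. s \<in> space D \<Longrightarrow> (\<lambda>y. f y s) differentiable (at x)"
    and sample_smooth: "\<And>s. s \<in> space D \<Longrightarrow> L-lipschitz_on UNIV (sample_gradient f s)"

section \<open>The algorithm\<close>

datatype setting = Online | Finite_Sum

text \<open>A batch is an indexed family, so repeated samples count with multiplicity.\<close>
definition batch_gradient ::
  "('a::real_inner \<Rightarrow> 's \<Rightarrow> real) \<Rightarrow> nat \<Rightarrow> (nat \<Rightarrow> 's) \<Rightarrow> 'a \<Rightarrow> 'a" where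
  "batch_gradient f b s x = (1 / real b) *\<^sub>R (\<Sum>i<b. sample_gradient f (s i) x)"

text \<open>The number of random samples drawn at step \<open>t\<close>. In the finite-sum setting a refresh step
  uses the full data set and draws nothing.\<close>
definition draws :: "setting \<Rightarrow> nat \<Rightarrow> nat \<Rightarrow> nat \<Rightarrow> nat \<Rightarrow> nat" where
  "draws S q b1 b2 t =
     (if q dvd t then (case S of Online \<Rightarrow> b1 | Finite_Sum \<Rightarrow> 0) else b2)"

text \<open>The past of step \<open>t\<close>: the iterates up to and including step \<open>t\<close> (hence also any randomness used
  to choose elements of proximal sets that shows in them) and all samples drawn before step \<open>t\<close>,
  where step \<open>s\<close> draws \<open>k s\<close> samples. The estimators \<open>g s\<close> with \<open>s < t\<close> are functions of it.\<close>
definition history ::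
  "(nat \<Rightarrow> nat) \<Rightarrow> (nat \<Rightarrow> nat \<Rightarrow> 'w \<Rightarrow> 's) \<Rightarrow> (nat \<Rightarrow> 'w \<Rightarrow> 'a) \<Rightarrow> nat \<Rightarrow> 'w
    \<Rightarrow> (nat \<Rightarrow> 'a) \<times> (nat \<times> nat \<Rightarrow> 's)" where
  "history k \<xi> x t \<omega> =
     ((\<lambda>s\<in>{..t}. x s \<omega>), (\<lambda>p\<in>(SIGMA s:{..<t}. {..<k s}). \<xi> (fst p) (snd p) \<omega>))"

definition history_space ::
  "'s measure \<Rightarrow> (nat \<Rightarrow> nat) \<Rightarrow> nat
    \<Rightarrow> ((nat \<Rightarrow> 'a::topological_space) \<times> (nat \<times> nat \<Rightarrow> 's)) measure" where
  "history_space D k t =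
     (\<Pi>\<^sub>M s\<in>{..t}. borel) \<Otimes>\<^sub>M (\<Pi>\<^sub>M p\<in>(SIGMA s:{..<t}. {..<k s}). D)"

text \<open>\<^const>\<open>prob_space.indep_var\<close> for random variables with values in different types.\<close>
definition (in prob_space) indep_pair ::
  "'b measure \<Rightarrow> ('a \<Rightarrow> 'b) \<Rightarrow> 'c measure \<Rightarrow> ('a \<Rightarrow> 'c) \<Rightarrow> bool" where
  "indep_pair N1 X1 N2 X2 \<longleftrightarrow>
     random_variable N1 X1 \<and> random_variable N2 X2 \<and>
     indep_set {X1 -` A \<inter> space M | A. A \<in> sets N1} {X2 -` A \<inter> space M | A. A \<in> sets N2}"

text \<open>A run of the algorithm on the probability space \<open>M\<close>: \<open>\<xi> t i\<close> is the \<open>i\<close>-th sample drawn at step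
  \<open>t\<close>, and the output is \<open>x R\<close>.\<close>
locale spgr_run = prob_space M
  for D :: "'s measure"
    and f :: "real ^ 'd \<Rightarrow> 's \<Rightarrow> real"
    and r :: "real ^ 'd \<Rightarrow> ereal"
    and x0 :: "real ^ 'd"
    and \<eta> :: real
    and S :: setting
    and T q b1 b2 :: nat
    and M :: "'w measure"
    and \<xi> :: "nat \<Rightarrow> nat \<Rightarrow> 'w \<Rightarrow> 's"
    and x g :: "nat \<Rightarrow> 'w \<Rightarrow> real ^ 'd"
    and R :: "'w \<Rightarrow> nat" +
  assumes params_pos: "T > 0" "q > 0" "b1 > 0" "b2 > 0"
    and initial: "\<And>\<omega>. \<omega> \<in> space M \<Longrightarrow> x 0 \<omega> = x0"
    and iterates_measurable: "\<And>t. t \<le> T \<Longrightarrow> x t \<in> borel_measurable M"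
    and samples_measurable:
      "\<And>t i. t < T \<Longrightarrow> i < draws S q b1 b2 t \<Longrightarrow> \<xi> t i \<in> measurable M D"
    and samples_law:
      "\<And>t i. t < T \<Longrightarrow> i < draws S q b1 b2 t \<Longrightarrow> distr M D (\<xi> t i) = D"
    and batch_indep:
      "\<And>t. t < T \<Longrightarrow> indep_vars (\<lambda>_. D) (\<xi> t) {..<draws S q b1 b2 t}"
    and batch_fresh:
      "\<And>t. t < T \<Longrightarrow>
         indep_pair (history_space D (draws S q b1 b2) t) (history (draws S q b1 b2) \<xi> x t)
           (\<Pi>\<^sub>M i\<in>{..<draws S q b1 b2 t}. D) (\<lambda>\<omega>. \<lambda>i\<in>{..<draws S q b1 b2 t}. \<xi> t i \<omega>)"
    and refresh:
      "\<And>t \<omega>. t < T \<Longrightarrow> q dvd t \<Longrightarrow> \<omega> \<in> space M \<Longrightarrow>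
         g t \<omega> = (case S of
                    Online \<Rightarrow> batch_gradient f b1 (\<lambda>i. \<xi> t i \<omega>) (x t \<omega>)
                  | Finite_Sum \<Rightarrow> gradient (expected_loss D f) (x t \<omega>))"
    and recursion:
      "\<And>t \<omega>. t < T \<Longrightarrow> \<not> q dvd t \<Longrightarrow> \<omega> \<in> space M \<Longrightarrow>
         g t \<omega> = batch_gradient f b2 (\<lambda>i. \<xi> t i \<omega>) (x t \<omega>)
               - batch_gradient f b2 (\<lambda>i. \<xi> t i \<omega>) (x (t - 1) \<omega>) + g (t - 1) \<omega>"
    and prox_step:
      "\<And>t \<omega>. t < T \<Longrightarrow> \<omega> \<in> space M \<Longrightarrow> x (Suc t) \<omega> \<in> prox \<eta> r (x t \<omega> - \<eta> *\<^sub>R g t \<omega>)"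
    and output_law:
      "distr M (uniform_count_measure {1..T}) R = uniform_count_measure {1..T}"
    and output_indep:
      "indep_pair (uniform_count_measure {1..T}) R
         (history_space D (draws S q b1 b2) T) (history (draws S q b1 b2) \<xi> x T)"

text \<open>The expectation of \<open>dist(0, \<cdot>)\<close> at the output is a nonnegative Lebesgue integral because the
  distance may be infinite. It would only be a lower integral for a non-measurable integrand, but for
  lower semicontinuous \<open>F\<close> the map \<open>z \<mapsto> dist(0, \<cdot>)\<close> is universally measurable.\<close>
definition expected_stationarity ::
  "'w measure \<Rightarrow> ('a::real_inner \<Rightarrow> ereal) \<Rightarrow> (nat \<Rightarrow> 'w \<Rightarrow> 'a) \<Rightarrow> ('w \<Rightarrow> nat) \<Rightarrow> ennreal" where
  "expected_stationarity M F x R = (\<integral>\<^sup>+\<omega>. dist_zero (frechet_subdiff F (x (R \<omega>) \<omega>)) \<partial>M)"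

section \<open>Complexity\<close>

text \<open>The samples processed in \<open>T\<close> steps. A refresh in the finite-sum setting processes the full data
  set and therefore counts with \<open>b1 = n\<close>, although it draws no random sample.\<close>
definition samples_processed :: "nat \<Rightarrow> nat \<Rightarrow> nat \<Rightarrow> nat \<Rightarrow> nat" where
  "samples_processed T q b1 b2 = (\<Sum>t<T. if q dvd t then b1 else b2)"

definition complexity_bound :: "nat \<Rightarrow> nat \<Rightarrow> nat \<Rightarrow> nat \<Rightarrow> nat" where
  "complexity_bound T q b1 b2 = b2 * T + b1 * nat \<lceil>real T / real q\<rceil>"

end

theory Submission
  imports Defs
begin

text \<open>
  Write \<open>e\<^sub>t = g\<^sub>t - \<nabla>f(x\<^sub>t)\<close> and \<open>d\<^sub>t = x\<^sub>t\<^sub>+\<^sub>1 - x\<^sub>t\<close>. Minimality of \<open>x\<^sub>t\<^sub>+\<^sub>1\<close> in the proximal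
  problem puts \<open>v\<^sub>t = \<nabla>f(x\<^sub>t\<^sub>+\<^sub>1) - g\<^sub>t - d\<^sub>t / \<eta>\<close> into the Frechet subdifferential of \<open>F\<close> at \<open>x\<^sub>t\<^sub>+\<^sub>1\<close>, and
  comparison with the competitor \<open>x\<^sub>t\<close> gives a descent inequality. Summed over \<open>t\<close>, it bounds both
  \<open>\<Sum>|d\<^sub>t|\<^sup>2\<close> and \<open>\<Sum>|v\<^sub>t|\<^sup>2\<close> by \<open>\<Delta>\<close> and \<open>\<Sum>|e\<^sub>t|\<^sup>2\<close>. Conversely the error is a martingale within an
  epoch, with increments of variance at most \<open>L\<^sup>2|d\<^sub>t|\<^sup>2 / q\<close>, so that over an epoch of length \<open>q\<close> the
  sum \<open>\<Sum>E|e\<^sub>t|\<^sup>2\<close> is at most \<open>L\<^sup>2\<Sum>E|d\<^sub>t|\<^sup>2\<close> plus the variance of the refresh steps. Since \<open>\<eta>L < 1/3\<close>,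
  the two bounds close up with the factor \<open>\<theta> > 0\<close>.
\<close>

section \<open>Proximal gradient steps\<close>

text \<open>Nothing controls the iterates in advance: a proximal set may have many elements, the
  choice among them may use extra randomness, and no moment of \<open>x t\<close> is given. Closing
  the two bounds means moving a multiple of the expected squared moves across an inequality, which
  is legitimate only once these moments are known to be finite. The one-step estimates for the error
  are therefore first stated for nonnegative integrals, which make sense unconditionally; finiteness
  then follows by an induction alternating between errors and moves, and only afterwards do real
  expectations appear.

  The role of conditional expectation is played by joint laws. The past is packed into one random
  variable, the \<open>history\<close>, whose joint law with the fresh batch is a product; likewise
  for the output index and the final history. This forces every quantity of interest to be written
  as a measurable function of the history.\<close>

lemma gderiv_gradient:
  fixes h :: "'a::euclidean_space \<Rightarrow> real"
  assumes "h differentiable (at x)"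
  shows "GDERIV h x :> gradient h x"
proof -
  obtain h' where h': "(h has_derivative h') (at x)"
    using assms by (auto simp: differentiable_def)
  \<comment> \<open>\<open>gradient\<close> is a definite description, so a representing vector must
    be exhibited and shown to be unique. \<open>w\<close> is the Riesz vector of the derivative in
    the orthonormal basis.\<close>
  define w where "w = (\<Sum>b\<in>Basis. h' b *\<^sub>R b)"
  interpret bounded_linear h' using h' by (rule has_derivative_bounded_linear)
  have "h' y = y \<bullet> w" for y
  proof -
    have "h' y = h' (\<Sum>b\<in>Basis. (y \<bullet> b) *\<^sub>R b)" by (simp add: euclidean_representation)
    also have "\<dots> = y \<bullet> w" by (simp add: sum scale w_def inner_sum_right mult.commute)
    finally show ?thesis .
  qed
  then have w: "GDERIV h x :> w"
    using h' by (simp add: gderiv_def) (metis (no_types, lifting) ext)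
  show ?thesis unfolding gradient_def
  proof (rule theI[where P="\<lambda>v. GDERIV h x :> v", OF w])
    fix v assume "GDERIV h x :> v"
    with w have "(\<lambda>y. y \<bullet> v) = (\<lambda>y. y \<bullet> w)"
      unfolding gderiv_def by (rule has_derivative_unique[rotated])
    then show "v = w" by (metis inner_commute vector_eq_rdot)
  qed
qed

text \<open>The descent lemma. Along the segment from \<open>x\<close> to \<open>y\<close>,
  subtracting the linear part and the quadratic bound from \<open>h\<close> leaves a function
  \<open>p\<close> whose derivative is nonpositive by Cauchy-Schwarz and the Lipschitz bound, so
  only its end values have to be compared.\<close>

lemma GDERIV_Lipschitz_upper:
  fixes h :: "'a::real_inner \<Rightarrow> real"
  assumes h: "\<And>x. GDERIV h x :> G x" and G: "L-lipschitz_on UNIV G"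
  shows "h y \<le> h x + G x \<bullet> (y - x) + L / 2 * (norm (y - x))\<^sup>2"
proof -
  define d where "d = y - x"
  define p where "p s = h (x + s *\<^sub>R d) - s * (G x \<bullet> d) - L / 2 * s\<^sup>2 * (norm d)\<^sup>2" for s
  have "p 1 \<le> p 0"
  proof (rule DERIV_nonpos_imp_nonincreasing[where a=0 and b=1 and f=p])
    fix s :: real assume s: "0 \<le> s" "s \<le> 1"
    have "((\<lambda>s. h (x + s *\<^sub>R d)) has_derivative (\<lambda>u. (u *\<^sub>R d) \<bullet> G (x + s *\<^sub>R d))) (at s)"
      by (rule has_derivative_compose[where f="\<lambda>s. x + s *\<^sub>R d" and g=h, OF _ h[unfolded gderiv_def]])
        (auto intro!: derivative_eq_intros)
    then have "((\<lambda>s. h (x + s *\<^sub>R d)) has_real_derivative d \<bullet> G (x + s *\<^sub>R d)) (at s)"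
      by (rule has_derivative_imp_has_field_derivative) simp
    then have D: "(p has_real_derivative (d \<bullet> G (x + s *\<^sub>R d) - G x \<bullet> d - L * s * (norm d)\<^sup>2)) (at s)"
      unfolding p_def[abs_def] by (auto intro!: derivative_eq_intros)
    have "(G (x + s *\<^sub>R d) - G x) \<bullet> d \<le> norm (G (x + s *\<^sub>R d) - G x) * norm d"
      by (rule norm_cauchy_schwarz)
    also have "\<dots> \<le> (L * norm (s *\<^sub>R d)) * norm d"
      using lipschitz_onD[OF G, of "x + s *\<^sub>R d" x] by (intro mult_right_mono) (auto simp: dist_norm)
    also have "\<dots> = L * s * (norm d)\<^sup>2" using s by (simp add: power2_eq_square)
    finally have "d \<bullet> G (x + s *\<^sub>R d) - G x \<bullet> d - L * s * (norm d)\<^sup>2 \<le> 0"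
      by (simp add: inner_diff_left inner_diff_right inner_commute)
    with D show "\<exists>z. (p has_real_derivative z) (at s) \<and> z \<le> 0" by blast
  qed simp
  then show ?thesis by (simp add: p_def d_def)
qed

lemma GDERIV_Lipschitz_lower:
  fixes h :: "'a::real_inner \<Rightarrow> real"
  assumes h: "\<And>x. GDERIV h x :> G x" and G: "L-lipschitz_on UNIV G"
  shows "h x + G x \<bullet> (y - x) - L / 2 * (norm (y - x))\<^sup>2 \<le> h y"
proof -
  have "- h y \<le> - h x + (- G x) \<bullet> (y - x) + L / 2 * (norm (y - x))\<^sup>2"
    using h G by (intro GDERIV_Lipschitz_upper) (auto intro: GDERIV_minus lipschitz_on_minus)
  then show ?thesis by simp
qed

section \<open>Proximal points and Frechet subgradients\<close>

lemma prox_finite: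
  assumes "proper_fun r" "z \<in> prox \<eta> r u"
  shows "\<bar>r z\<bar> \<noteq> \<infinity>"
proof -
  obtain y where y: "r y \<noteq> \<infinity>" using assms(1) by (auto simp: proper_fun_def)
  have "\<not> (ereal (1 / (2 * \<eta>) * (norm (y - u))\<^sup>2) + r y < ereal (1 / (2 * \<eta>) * (norm (z - u))\<^sup>2) + r z)"
    using assms(2) by (auto simp: prox_def is_arg_min_def)
  then have "r z \<noteq> \<infinity>" using y by auto
  moreover have "r z \<noteq> -\<infinity>" using assms(1) by (auto simp: proper_fun_def)
  ultimately show ?thesis by auto
qed

text \<open>Minimality with both penalties moved to the side of \<open>z\<close>, where every term
  is finite. In this form an infinite \<open>r y\<close> is harmless.\<close>

lemma prox_le:
  assumes "proper_fun r" "z \<in> prox \<eta> r u"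
  shows "ereal (real_of_ereal (r z) + 1 / (2 * \<eta>) * ((norm (z - u))\<^sup>2 - (norm (y - u))\<^sup>2)) \<le> r y"
proof -
  have "\<not> (ereal (1 / (2 * \<eta>) * (norm (y - u))\<^sup>2) + r y < ereal (1 / (2 * \<eta>) * (norm (z - u))\<^sup>2) + r z)"
    using assms(2) by (auto simp: prox_def is_arg_min_def)
  moreover obtain \<rho> where "r z = ereal \<rho>" using prox_finite[OF assms] by auto
  moreover have "r y \<noteq> -\<infinity>" using assms(1) by (auto simp: proper_fun_def)
  ultimately show ?thesis by (cases "r y") (auto simp: algebra_simps)
qed

text \<open>Proximal minimality and the lower quadratic bound on \<open>h\<close> add up to an
  inequality \<open>F y \<ge> F z + v \<bullet> (y - z) - C * norm (y - z) ^ 2\<close>. After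
  division by \<open>norm (y - z)\<close> the remainder still tends to 0, which is the Frechet
  condition.\<close>

lemma prox_frechet_subgradient:
  fixes h :: "'a::euclidean_space \<Rightarrow> real"
  assumes h: "\<And>x. GDERIV h x :> G x" and G: "L-lipschitz_on UNIV G"
    and r: "proper_fun r" and z: "z \<in> prox \<eta> r (x - \<eta> *\<^sub>R g)" and \<eta>: "\<eta> > 0"
  shows "G z - g - (1 / \<eta>) *\<^sub>R (z - x) \<in> frechet_subdiff (\<lambda>y. ereal (h y) + r y) z"
proof -
  define v where "v = G z - g - (1 / \<eta>) *\<^sub>R (z - x)"
  \<comment> \<open>\<open>L / 2\<close> is the loss in the lower quadratic bound for
    \<open>h\<close>, and \<open>1 / (2 * \<eta>)\<close> comes from the proximal penalty.\<close>
  define C where "C = L / 2 + 1 / (2 * \<eta>)"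
  let ?F = "\<lambda>y. ereal (h y) + r y"
  obtain \<rho> where \<rho>: "r z = ereal \<rho>" using prox_finite[OF r z] by auto
  have "((\<lambda>y. ereal (- C * norm (y - z))) \<longlongrightarrow> ereal (- C * norm (z - z))) (at z)"
    by (intro tendsto_intros)
  then have "((\<lambda>y. ereal (- C * norm (y - z))) \<longlongrightarrow> 0) (at z)"
    by (simp add: zero_ereal_def)
  then have "Liminf (at z) (\<lambda>y. ereal (- C * norm (y - z))) = 0"
    by (rule lim_imp_Liminf[OF trivial_limit_at])
  moreover have "Liminf (at z) (\<lambda>y. ereal (- C * norm (y - z)))
     \<le> Liminf (at z) (\<lambda>y. (?F y - ?F z - ereal (v \<bullet> (y - z))) / ereal (norm (y - z)))"
  proof (rule Liminf_mono)
    have "ereal (- C * norm (y - z)) \<le> (?F y - ?F z - ereal (v \<bullet> (y - z))) / ereal (norm (y - z))"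
      if "y \<noteq> z" for y
    proof (cases "r y")
      case (real a)
      have "(norm (y - (x - \<eta> *\<^sub>R g)))\<^sup>2
          = (norm (z - (x - \<eta> *\<^sub>R g)))\<^sup>2 + 2 * ((z - x + \<eta> *\<^sub>R g) \<bullet> (y - z)) + (norm (y - z))\<^sup>2"
        by (simp add: power2_norm_eq_inner algebra_simps inner_commute)
      moreover have "\<rho> + 1 / (2 * \<eta>) * ((norm (z - (x - \<eta> *\<^sub>R g)))\<^sup>2 - (norm (y - (x - \<eta> *\<^sub>R g)))\<^sup>2) \<le> a"
        using prox_le[OF r z, of y] by (simp add: \<rho> real)
      ultimately have "\<rho> - 1 / (2 * \<eta>) * (2 * ((z - x + \<eta> *\<^sub>R g) \<bullet> (y - z)) + (norm (y - z))\<^sup>2) \<le> a"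
        by (simp only: ring_distribs)
      moreover have "1 / (2 * \<eta>) * (2 * ((z - x + \<eta> *\<^sub>R g) \<bullet> (y - z)) + (norm (y - z))\<^sup>2)
           = (1 / \<eta>) * ((z - x) \<bullet> (y - z)) + g \<bullet> (y - z) + 1 / (2 * \<eta>) * (norm (y - z))\<^sup>2"
        unfolding inner_add_left inner_scaleR_left using \<eta> by (simp add: field_simps)
      moreover have "h z + G z \<bullet> (y - z) - L / 2 * (norm (y - z))\<^sup>2 \<le> h y"
        by (rule GDERIV_Lipschitz_lower[OF h G])
      ultimately have "- C * (norm (y - z))\<^sup>2 \<le> h y + a - (h z + \<rho>) - v \<bullet> (y - z)"
        by (simp add: C_def v_def inner_diff_left left_diff_distrib)
      then have "- C * norm (y - z) \<le> (h y + a - (h z + \<rho>) - v \<bullet> (y - z)) / norm (y - z)"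
        using that by (simp add: field_simps power2_eq_square)
      then show ?thesis using that by (simp add: real \<rho> divide_ereal_def divide_inverse)
    next
      case PInf
      then show ?thesis using that by (simp add: \<rho> divide_ereal_def ereal_mult_infty)
    next
      case MInf
      then show ?thesis using r by (auto simp: proper_fun_def)
    qed
    then show "\<forall>\<^sub>F y in at z. ereal (- C * norm (y - z))
       \<le> (?F y - ?F z - ereal (v \<bullet> (y - z))) / ereal (norm (y - z))"
      by (simp add: eventually_at_filter)
  qed
  ultimately show ?thesis by (simp add: frechet_subdiff_def \<rho> v_def)
qed

text \<open>A deterministic single step, interpreted later for each time and each outcome.
  Assumption \<open>rx\<close> makes \<open>\<Phi> x\<close> a genuine value: at later iterates it
  follows from the preceding proximal step, at the start from the finite initial gap.\<close>

locale prox_gradient_step =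
  fixes h :: "'a::euclidean_space \<Rightarrow> real" and G :: "'a \<Rightarrow> 'a" and r :: "'a \<Rightarrow> ereal"
    and L \<eta> :: real and x g z :: 'a
  assumes h: "\<And>x. GDERIV h x :> G x" and G: "L-lipschitz_on UNIV G" and L: "L > 0"
    and r: "proper_fun r" and z: "z \<in> prox \<eta> r (x - \<eta> *\<^sub>R g)" and \<eta>: "\<eta> > 0"
    and rx: "\<bar>r x\<bar> \<noteq> \<infinity>"
begin

abbreviation "\<Phi> y \<equiv> h y + real_of_ereal (r y)"

text \<open>The point \<open>x\<close> itself is the competitor. The inner product with the error is
  left unestimated because it is used in two ways: \<open>descent\<close> splits it, while
  \<open>stationarity\<close> needs it as it stands to bound a cross term.\<close>

lemma descent_inner:
  "\<Phi> z + (g - G x) \<bullet> (z - x) + (1 / (2 * \<eta>) - L / 2) * (norm (z - x))\<^sup>2 \<le> \<Phi> x"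
proof -
  have "(norm (z - (x - \<eta> *\<^sub>R g)))\<^sup>2 - (norm (x - (x - \<eta> *\<^sub>R g)))\<^sup>2
      = (norm (z - x))\<^sup>2 + 2 * \<eta> * (g \<bullet> (z - x))"
    unfolding power2_norm_eq_inner by (simp add: algebra_simps inner_commute power2_eq_square)
  then have "ereal (real_of_ereal (r z) + 1 / (2 * \<eta>) * ((norm (z - x))\<^sup>2 + 2 * \<eta> * (g \<bullet> (z - x)))) \<le> r x"
    using prox_le[OF r z, of x] by metis
  then have "real_of_ereal (r z) + 1 / (2 * \<eta>) * ((norm (z - x))\<^sup>2 + 2 * \<eta> * (g \<bullet> (z - x))) \<le> real_of_ereal (r x)"
    using rx by (cases "r x") auto
  then have "real_of_ereal (r z) + 1 / (2 * \<eta>) * (norm (z - x))\<^sup>2 + g \<bullet> (z - x) \<le> real_of_ereal (r x)"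
    using \<eta> by (simp add: distrib_left)
  moreover have "h z \<le> h x + G x \<bullet> (z - x) + L / 2 * (norm (z - x))\<^sup>2"
    by (rule GDERIV_Lipschitz_upper[OF h G])
  ultimately show ?thesis by (simp add: inner_diff_left left_diff_distrib)
qed

lemma descent:
  "\<Phi> z + (1 / (2 * \<eta>) - L) * (norm (z - x))\<^sup>2 \<le> \<Phi> x + (norm (g - G x))\<^sup>2 / (2 * L)"
proof -
  \<comment> \<open>Young's inequality with weight \<open>L\<close>, as a completed square divided
    by \<open>2 * L\<close>. It costs another \<open>L / 2\<close> in the coefficient of the squared
    move.\<close>
  have "0 \<le> (norm ((g - G x) + L *\<^sub>R (z - x)))\<^sup>2" by simp
  also have "\<dots> = (norm (g - G x))\<^sup>2 + 2 * L * ((g - G x) \<bullet> (z - x)) + L\<^sup>2 * (norm (z - x))\<^sup>2"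
    unfolding power2_norm_eq_inner
    by (simp add: inner_add_left inner_add_right inner_commute power2_eq_square)
  finally have "0 \<le> ((norm (g - G x))\<^sup>2 + 2 * L * ((g - G x) \<bullet> (z - x)) + L\<^sup>2 * (norm (z - x))\<^sup>2) / (2 * L)"
    using L by simp
  also have "\<dots> = (norm (g - G x))\<^sup>2 / (2 * L) + (g - G x) \<bullet> (z - x) + L / 2 * (norm (z - x))\<^sup>2"
    using L by (simp add: field_simps power2_eq_square)
  finally show ?thesis using descent_inner by (simp add: left_diff_distrib)
qed

text \<open>Expand the square of \<open>(k - e) - d / \<eta>\<close>. The cross term with
  \<open>e\<close> is bounded by the decrease of \<open>\<Phi>\<close> through
  \<open>descent_inner\<close>, which telescopes later; its negative multiple of the squared move
  cancels the \<open>1 / \<eta>\<^sup>2\<close> contributed by \<open>d / \<eta>\<close>, and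
  \<open>3 * L / \<eta>\<close> is what remains.\<close>

lemma stationarity:
  "(norm (G z - g - (1 / \<eta>) *\<^sub>R (z - x)))\<^sup>2
    \<le> 2 * (norm (g - G x))\<^sup>2 + (2 * L\<^sup>2 + 3 * L / \<eta>) * (norm (z - x))\<^sup>2 + 2 / \<eta> * (\<Phi> x - \<Phi> z)"
proof -
  define e d k where "e = g - G x" and "d = z - x" and "k = G z - G x"
  have nk: "norm k \<le> L * norm d"
    using lipschitz_onD[OF G, of z x] by (simp add: k_def d_def dist_norm)
  have k2: "(norm k)\<^sup>2 \<le> L\<^sup>2 * (norm d)\<^sup>2"
    using power_mono[OF nk, of 2] by (simp add: power_mult_distrib)
  \<comment> \<open>Parallelogram identity; the square of \<open>k + e\<close> is dropped
    next.\<close>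
  have "(norm (k - e))\<^sup>2 + (norm (k + e))\<^sup>2 = 2 * (norm k)\<^sup>2 + 2 * (norm e)\<^sup>2"
    unfolding power2_norm_eq_inner
    by (simp add: inner_add_left inner_add_right inner_diff_left inner_diff_right inner_commute)
  then have ke: "(norm (k - e))\<^sup>2 \<le> 2 * L\<^sup>2 * (norm d)\<^sup>2 + 2 * (norm e)\<^sup>2"
    using k2 zero_le_power2[of "norm (k + e)"] by linarith
  have "- (k \<bullet> d) \<le> norm k * norm d" using norm_cauchy_schwarz[of "-k" d] by simp
  also have "\<dots> \<le> L * (norm d)\<^sup>2" using mult_right_mono[OF nk, of "norm d"] by (simp add: power2_eq_square mult.assoc)
  finally have kd: "- (k \<bullet> d) \<le> L * (norm d)\<^sup>2" .
  have ed: "e \<bullet> d \<le> \<Phi> x - \<Phi> z - (1 / (2 * \<eta>) - L / 2) * (norm d)\<^sup>2"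
    using descent_inner by (simp add: e_def d_def)
  have "G z - g - (1 / \<eta>) *\<^sub>R (z - x) = (k - e) - (1 / \<eta>) *\<^sub>R d"
    by (simp add: k_def e_def d_def)
  moreover have "(norm (a - s *\<^sub>R d))\<^sup>2 = (norm a)\<^sup>2 - 2 * s * (a \<bullet> d) + s\<^sup>2 * (norm d)\<^sup>2" for a and s :: real
    unfolding power2_norm_eq_inner
    by (simp add: inner_diff_left inner_diff_right inner_commute power2_eq_square)
  ultimately have "(norm (G z - g - (1 / \<eta>) *\<^sub>R (z - x)))\<^sup>2
     = (norm (k - e))\<^sup>2 + 2 / \<eta> * (e \<bullet> d - k \<bullet> d) + 1 / \<eta>\<^sup>2 * (norm d)\<^sup>2"
    by (simp add: inner_diff_left power_divide right_diff_distrib)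
  also have "\<dots> \<le> (2 * L\<^sup>2 * (norm d)\<^sup>2 + 2 * (norm e)\<^sup>2)
     + 2 / \<eta> * ((\<Phi> x - \<Phi> z - (1 / (2 * \<eta>) - L / 2) * (norm d)\<^sup>2) + L * (norm d)\<^sup>2) + 1 / \<eta>\<^sup>2 * (norm d)\<^sup>2"
    using ke ed kd \<eta> by (intro add_mono mult_left_mono) auto
  also have "\<dots> = 2 * (norm e)\<^sup>2 + (2 * L\<^sup>2 + 3 * L / \<eta>) * (norm d)\<^sup>2 + 2 / \<eta> * (\<Phi> x - \<Phi> z)"
    using \<eta> by (simp add: field_simps power2_eq_square)
  finally show ?thesis by (simp add: e_def d_def)
qed

end

section \<open>Mini-batches\<close>

text \<open>A Caratheodory function is evaluated along simple functions converging to the second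
  argument.\<close>
lemma borel_measurable_Caratheodory:
  fixes G :: "'s \<Rightarrow> 'a::{metric_space, second_countable_topology} \<Rightarrow> 'b::metric_space"
  assumes G: "\<And>a. (\<lambda>s. G s a) \<in> borel_measurable D"
    and cont: "\<And>s. s \<in> space D \<Longrightarrow> continuous_on UNIV (G s)"
    and Z: "Z \<in> measurable N D" and X: "X \<in> borel_measurable N"
  shows "(\<lambda>\<omega>. G (Z \<omega>) (X \<omega>)) \<in> borel_measurable N"
proof -
  obtain F where F: "\<And>i. simple_function N (F i)"
      and lim: "\<And>\<omega>. \<omega> \<in> space N \<Longrightarrow> (\<lambda>i. F i \<omega>) \<longlonglongrightarrow> X \<omega>"
    using borel_measurable_implies_sequence_metric[OF X, of undefined] by blast
  show ?thesis
  proof (rule borel_measurable_LIMSEQ_metric)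
    fix i
    \<comment> \<open>Finitely many values: with the second argument fixed at each of them,
      measurability of \<open>G\<close> in its first argument suffices.\<close>
    have fin: "finite (F i ` space N)"
      using F[of i] by (simp add: simple_function_def)
    then have "F i \<in> measurable N (count_space (F i ` space N))"
      using F[of i] by (auto simp: measurable_count_space_eq2 simple_function_def)
    then show "(\<lambda>\<omega>. G (Z \<omega>) (F i \<omega>)) \<in> borel_measurable N"
      by (rule measurable_compose_countable'[rotated])
        (use fin in \<open>auto intro: measurable_compose[OF Z G] countable_finite\<close>)
  next
    fix \<omega> assume \<omega>: "\<omega> \<in> space N"
    then have "Z \<omega> \<in> space D" using Z by (rule measurable_space[rotated])
    from cont[OF this] have "isCont (G (Z \<omega>)) (X \<omega>)"
      by (simp add: continuous_on_eq_continuous_at)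
    then show "(\<lambda>i. G (Z \<omega>) (F i \<omega>)) \<longlonglongrightarrow> G (Z \<omega>) (X \<omega>)"
      using lim[OF \<omega>] by (rule isCont_tendsto_compose)
  qed
qed

text \<open>Independence of the generated sigma-algebras determines the joint law on rectangles,
  hence everywhere. The product form is what Fubini's theorem acts on.\<close>

lemma (in prob_space) distr_indep_pair:
  assumes "indep_pair N1 X1 N2 X2"
  shows "distr M (N1 \<Otimes>\<^sub>M N2) (\<lambda>\<omega>. (X1 \<omega>, X2 \<omega>)) = distr M N1 X1 \<Otimes>\<^sub>M distr M N2 X2"
proof -
  have [measurable]: "X1 \<in> measurable M N1" "X2 \<in> measurable M N2"
    and ind: "indep_set {X1 -` A \<inter> space M | A. A \<in> sets N1} {X2 -` A \<inter> space M | A. A \<in> sets N2}"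
    using assms by (auto simp: indep_pair_def)
  interpret P1: prob_space "distr M N1 X1" by (rule prob_space_distr) simp
  interpret P2: prob_space "distr M N2 X2" by (rule prob_space_distr) simp
  have "distr M N1 X1 \<Otimes>\<^sub>M distr M N2 X2 = distr M (N1 \<Otimes>\<^sub>M N2) (\<lambda>\<omega>. (X1 \<omega>, X2 \<omega>))"
  proof (rule pair_measure_eqI)
    fix A B assume "A \<in> sets (distr M N1 X1)" "B \<in> sets (distr M N2 X2)"
    then have [measurable]: "A \<in> sets N1" "B \<in> sets N2" by auto
    have "prob ((X1 -` A \<inter> space M) \<inter> (X2 -` B \<inter> space M))
        = prob (X1 -` A \<inter> space M) * prob (X2 -` B \<inter> space M)"
      by (rule indep_setD[OF ind]) auto
    moreover have "(\<lambda>\<omega>. (X1 \<omega>, X2 \<omega>)) -` (A \<times> B) \<inter> space M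
        = (X1 -` A \<inter> space M) \<inter> (X2 -` B \<inter> space M)" by auto
    ultimately show "emeasure (distr M N1 X1) A * emeasure (distr M N2 X2) B
        = emeasure (distr M (N1 \<Otimes>\<^sub>M N2) (\<lambda>\<omega>. (X1 \<omega>, X2 \<omega>))) (A \<times> B)"
      by (simp add: emeasure_distr emeasure_eq_measure ennreal_mult)
  qed (auto intro: P1.sigma_finite_measure_axioms P2.sigma_finite_measure_axioms)
  then show ?thesis ..
qed

text \<open>The cross term with \<open>w\<close> integrates to 0 because \<open>Y\<close> is
  centred. In the applications \<open>w\<close> collects everything already determined before the
  sample is drawn.\<close>

lemma (in prob_space) nn_integral_norm_shift:
  fixes Y :: "'a \<Rightarrow> 'b::euclidean_space"
  assumes Y: "integrable M Y" and zero: "(\<integral>s. Y s \<partial>M) = 0"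
    and V: "(\<integral>\<^sup>+s. ennreal ((norm (Y s))\<^sup>2) \<partial>M) \<le> ennreal V"
  shows "(\<integral>\<^sup>+s. ennreal ((norm (w + Y s))\<^sup>2) \<partial>M) \<le> ennreal ((norm w)\<^sup>2) + ennreal V"
proof -
  note [measurable] = borel_measurable_integrable[OF Y]
  have Y2: "integrable M (\<lambda>s. (norm (Y s))\<^sup>2)"
    using V by (intro integrableI_nonneg) (auto simp: less_top[symmetric] top_unique)
  have wY: "integrable M (\<lambda>s. w \<bullet> Y s)" "(\<integral>s. w \<bullet> Y s \<partial>M) = 0"
    using Y zero by auto
  have eq: "(norm (w + Y s))\<^sup>2 = (norm w)\<^sup>2 + 2 * (w \<bullet> Y s) + (norm (Y s))\<^sup>2" for s
    by (simp add: power2_norm_eq_inner inner_add_left inner_add_right inner_commute)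
  have "integrable M (\<lambda>s. (norm (w + Y s))\<^sup>2)"
    unfolding eq using Y2 wY by auto
  then have "(\<integral>\<^sup>+s. ennreal ((norm (w + Y s))\<^sup>2) \<partial>M) = ennreal (\<integral>s. (norm (w + Y s))\<^sup>2 \<partial>M)"
    by (intro nn_integral_eq_integral) auto
  also have "(\<integral>s. (norm (w + Y s))\<^sup>2 \<partial>M) = (norm w)\<^sup>2 + (\<integral>s. (norm (Y s))\<^sup>2 \<partial>M)"
    using Y2 wY by (simp add: eq prob_space)
  also have "ennreal \<dots> = ennreal ((norm w)\<^sup>2) + ennreal (\<integral>s. (norm (Y s))\<^sup>2 \<partial>M)"
    by (simp add: ennreal_plus)
  also have "ennreal (\<integral>s. (norm (Y s))\<^sup>2 \<partial>M) = (\<integral>\<^sup>+s. ennreal ((norm (Y s))\<^sup>2) \<partial>M)"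
    using Y2 by (intro nn_integral_eq_integral[symmetric]) auto
  finally show ?thesis using V by (simp add: add_left_mono)
qed

text \<open>Peel off the last sample by Fubini. With the others frozen, their sum and
  \<open>w\<close> together form the shift of \<open>nn_integral_norm_shift\<close>, so each sample
  adds just one \<open>V\<close>.\<close>

lemma (in prob_space) nn_integral_norm_sum_iid:
  fixes Y :: "'a \<Rightarrow> 'b::euclidean_space"
  assumes Y: "integrable M Y" and zero: "(\<integral>s. Y s \<partial>M) = 0"
    and V: "(\<integral>\<^sup>+s. ennreal ((norm (Y s))\<^sup>2) \<partial>M) \<le> ennreal V"
  shows "(\<integral>\<^sup>+z. ennreal ((norm (w + (\<Sum>i<k. Y (z i))))\<^sup>2) \<partial>PiM {..<k} (\<lambda>_. M))
           \<le> ennreal ((norm w)\<^sup>2) + of_nat k * ennreal V"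
proof (induction k)
  case 0
  then show ?case by (simp add: PiM_empty nn_integral_count_space_finite)
next
  case (Suc k)
  note [measurable] = borel_measurable_integrable[OF Y]
  interpret P: product_prob_space "\<lambda>_. M" UNIV ..
  interpret Pk: prob_space "PiM {..<k} (\<lambda>_. M)" by (rule prob_space_PiM) (rule prob_space_axioms)
  have meas: "(\<lambda>z. ennreal ((norm (w + (\<Sum>i<k. Y (z i))))\<^sup>2)) \<in> borel_measurable (PiM {..<k} (\<lambda>_. M))"
    by simp
  have "(\<integral>\<^sup>+z. ennreal ((norm (w + (\<Sum>i<Suc k. Y (z i))))\<^sup>2) \<partial>PiM {..<Suc k} (\<lambda>_. M))
      = (\<integral>\<^sup>+z. \<integral>\<^sup>+s. ennreal ((norm (w + (\<Sum>i<Suc k. Y ((z(k := s)) i))))\<^sup>2) \<partial>M \<partial>PiM {..<k} (\<lambda>_. M))"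
    unfolding lessThan_Suc by (rule P.product_nn_integral_insert) auto
  also have "\<dots> = (\<integral>\<^sup>+z. \<integral>\<^sup>+s. ennreal ((norm ((w + (\<Sum>i<k. Y (z i))) + Y s))\<^sup>2) \<partial>M \<partial>PiM {..<k} (\<lambda>_. M))"
    by (simp add: add.assoc cong: sum.cong_simp)
  also have "\<dots> \<le> (\<integral>\<^sup>+z. ennreal ((norm (w + (\<Sum>i<k. Y (z i))))\<^sup>2) + ennreal V \<partial>PiM {..<k} (\<lambda>_. M))"
    by (intro nn_integral_mono nn_integral_norm_shift[OF assms])
  also have "\<dots> = (\<integral>\<^sup>+z. ennreal ((norm (w + (\<Sum>i<k. Y (z i))))\<^sup>2) \<partial>PiM {..<k} (\<lambda>_. M)) + ennreal V"
    using Pk.emeasure_space_1 meas by (simp add: nn_integral_add)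
  also have "\<dots> \<le> (ennreal ((norm w)\<^sup>2) + of_nat k * ennreal V) + ennreal V"
    by (intro add_right_mono Suc)
  also have "\<dots> = ennreal ((norm w)\<^sup>2) + of_nat (Suc k) * ennreal V"
    by (simp add: distrib_right add_ac)
  finally show ?case .
qed

lemma (in prob_space) nn_integral_norm_mean_iid:
  fixes Y :: "'a \<Rightarrow> 'b::euclidean_space"
  assumes Y: "integrable M Y" and zero: "(\<integral>s. Y s \<partial>M) = 0"
    and V: "(\<integral>\<^sup>+s. ennreal ((norm (Y s))\<^sup>2) \<partial>M) \<le> ennreal V" "0 \<le> V" and k: "k > 0"
  shows "(\<integral>\<^sup>+z. ennreal ((norm (w + (1 / real k) *\<^sub>R (\<Sum>i<k. Y (z i))))\<^sup>2) \<partial>PiM {..<k} (\<lambda>_. M))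
           \<le> ennreal ((norm w)\<^sup>2 + V / real k)"
proof -
  note [measurable] = borel_measurable_integrable[OF Y]
  \<comment> \<open>Pull the factor \<open>1 / k\<close> out of the norm, at the price of scaling
    \<open>w\<close> by \<open>k\<close>; its square turns \<open>k * V\<close> into
    \<open>V / k\<close>.\<close>
  have "w + (1 / real k) *\<^sub>R a = (1 / real k) *\<^sub>R (real k *\<^sub>R w + a)" for a
    using k by (simp add: scaleR_add_right)
  moreover have "ennreal ((norm ((1 / real k) *\<^sub>R v))\<^sup>2) = ennreal ((1 / real k)\<^sup>2) * ennreal ((norm v)\<^sup>2)"
    for v :: 'b
    by (simp add: power_mult_distrib power_divide flip: ennreal_mult)
  ultimately have "(\<integral>\<^sup>+z. ennreal ((norm (w + (1 / real k) *\<^sub>R (\<Sum>i<k. Y (z i))))\<^sup>2) \<partial>PiM {..<k} (\<lambda>_. M))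
     = (\<integral>\<^sup>+z. ennreal ((1 / real k)\<^sup>2) * ennreal ((norm (real k *\<^sub>R w + (\<Sum>i<k. Y (z i))))\<^sup>2) \<partial>PiM {..<k} (\<lambda>_. M))"
    by metis
  also have "\<dots> = ennreal ((1 / real k)\<^sup>2) * (\<integral>\<^sup>+z. ennreal ((norm (real k *\<^sub>R w + (\<Sum>i<k. Y (z i))))\<^sup>2) \<partial>PiM {..<k} (\<lambda>_. M))"
    by (rule nn_integral_cmult) simp
  also have "\<dots> \<le> ennreal ((1 / real k)\<^sup>2) * (ennreal ((norm (real k *\<^sub>R w))\<^sup>2) + of_nat k * ennreal V)"
    by (intro mult_left_mono nn_integral_norm_sum_iid assms) auto
  also have "\<dots> = ennreal ((1 / real k)\<^sup>2 * ((norm (real k *\<^sub>R w))\<^sup>2 + real k * V))"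
    using V by (simp add: ennreal_mult' ennreal_plus flip: ennreal_of_nat_eq_real_of_nat)
  also have "(1 / real k)\<^sup>2 * ((norm (real k *\<^sub>R w))\<^sup>2 + real k * V) = (norm w)\<^sup>2 + V / real k"
    using k by (simp add: power_mult_distrib field_simps power2_eq_square)
  finally show ?thesis .
qed

text \<open>By Fubini's theorem the past \<open>h\<close> may be frozen, which leaves an i.i.d. batch.\<close>
lemma (in prob_space) nn_integral_norm_mean_fresh:
  fixes e :: "'h \<Rightarrow> 'b::euclidean_space" and Y :: "'h \<Rightarrow> 's \<Rightarrow> 'b"
  assumes D: "prob_space D" and ind: "indep_pair N X (PiM {..<k} (\<lambda>_. D)) Z"
    and law: "distr M (PiM {..<k} (\<lambda>_. D)) Z = PiM {..<k} (\<lambda>_. D)"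
    and e[measurable]: "e \<in> borel_measurable N"
    and Y[measurable]: "(\<lambda>(h, s). Y h s) \<in> borel_measurable (N \<Otimes>\<^sub>M D)"
    and int: "\<And>h. h \<in> space N \<Longrightarrow> integrable D (Y h)"
    and zero: "\<And>h. h \<in> space N \<Longrightarrow> (\<integral>s. Y h s \<partial>D) = 0"
    and V: "\<And>h. h \<in> space N \<Longrightarrow> (\<integral>\<^sup>+s. ennreal ((norm (Y h s))\<^sup>2) \<partial>D) \<le> ennreal (V h)"
    and V0: "\<And>h. 0 \<le> V h" and V_meas[measurable]: "V \<in> borel_measurable N" and k: "k > 0"
  shows "(\<integral>\<^sup>+\<omega>. ennreal ((norm (e (X \<omega>) + (1 / real k) *\<^sub>R (\<Sum>i<k. Y (X \<omega>) (Z \<omega> i))))\<^sup>2) \<partial>M)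
           \<le> (\<integral>\<^sup>+\<omega>. ennreal ((norm (e (X \<omega>)))\<^sup>2 + V (X \<omega>) / real k) \<partial>M)"
proof -
  let ?P = "PiM {..<k} (\<lambda>_. D)"
  interpret D: prob_space D by fact
  interpret P: prob_space ?P by (rule prob_space_PiM) (rule D)
  have [measurable]: "X \<in> measurable M N" "Z \<in> measurable M ?P"
    using ind by (auto simp: indep_pair_def)
  have Yi[measurable]: "(\<lambda>p. Y (fst p) (snd p i)) \<in> borel_measurable (N \<Otimes>\<^sub>M ?P)" if "i < k" for i
  proof -
    have "(\<lambda>p. (fst p, snd p i)) \<in> measurable (N \<Otimes>\<^sub>M ?P) (N \<Otimes>\<^sub>M D)"
      using that by (intro measurable_Pair measurable_fst
          measurable_compose[OF measurable_snd measurable_component_singleton]) auto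
    from measurable_compose[OF this Y] show ?thesis by simp
  qed
  define u where "u = (\<lambda>p. ennreal ((norm (e (fst p) + (1 / real k) *\<^sub>R (\<Sum>i<k. Y (fst p) (snd p i))))\<^sup>2))"
  have u[measurable]: "u \<in> borel_measurable (N \<Otimes>\<^sub>M ?P)"
    unfolding u_def by measurable
  have "(\<integral>\<^sup>+\<omega>. u (X \<omega>, Z \<omega>) \<partial>M) = (\<integral>\<^sup>+p. u p \<partial>distr M (N \<Otimes>\<^sub>M ?P) (\<lambda>\<omega>. (X \<omega>, Z \<omega>)))"
    by (subst nn_integral_distr) auto
  also have "\<dots> = (\<integral>\<^sup>+p. u p \<partial>(distr M N X \<Otimes>\<^sub>M ?P))"
    using distr_indep_pair[OF ind] law by simp
  also have "\<dots> = (\<integral>\<^sup>+h. \<integral>\<^sup>+z. u (h, z) \<partial>?P \<partial>distr M N X)"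
    by (rule P.nn_integral_fst[symmetric]) (simp cong: measurable_cong_sets)
  also have "\<dots> \<le> (\<integral>\<^sup>+h. ennreal ((norm (e h))\<^sup>2 + V h / real k) \<partial>distr M N X)"
    by (intro nn_integral_mono) (auto simp: u_def intro!: D.nn_integral_norm_mean_iid int zero V V0 k)
  also have "\<dots> = (\<integral>\<^sup>+\<omega>. ennreal ((norm (e (X \<omega>)))\<^sup>2 + V (X \<omega>) / real k) \<partial>M)"
    by (subst nn_integral_distr) auto
  finally show ?thesis by (simp add: u_def)
qed

text \<open>Centring only lowers the second moment. The triangle inequality would give
  \<open>4 * c\<^sup>2\<close> and spoil the constants downstream.\<close>

lemma (in prob_space) nn_integral_norm_centered:
  fixes W :: "'a \<Rightarrow> 'b::euclidean_space"
  assumes W[measurable]: "W \<in> borel_measurable M" and c: "\<And>s. s \<in> space M \<Longrightarrow> norm (W s) \<le> c"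
  shows "(\<integral>\<^sup>+s. ennreal ((norm (W s - (\<integral>s. W s \<partial>M)))\<^sup>2) \<partial>M) \<le> ennreal (c\<^sup>2)"
proof -
  define m where "m = (\<integral>s. W s \<partial>M)"
  have int: "integrable M W"
    by (rule integrable_const_bound[of _ c]) (auto intro: c)
  have c2: "(norm (W s))\<^sup>2 \<le> c\<^sup>2" if "s \<in> space M" for s
    using c[OF that] by (intro power_mono) auto
  have int2: "integrable M (\<lambda>s. (norm (W s))\<^sup>2)"
    by (rule integrable_const_bound[of _ "c\<^sup>2"]) (auto intro: c2)
  have int3: "integrable M (\<lambda>s. m \<bullet> W s)" "(\<integral>s. m \<bullet> W s \<partial>M) = (norm m)\<^sup>2"
    using int by (auto simp: m_def power2_norm_eq_inner)
  have eq: "(norm (W s - m))\<^sup>2 = (norm (W s))\<^sup>2 - 2 * (m \<bullet> W s) + (norm m)\<^sup>2" for s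
    by (simp add: power2_norm_eq_inner inner_diff_left inner_diff_right inner_commute)
  have "integrable M (\<lambda>s. (norm (W s - m))\<^sup>2)"
    unfolding eq using int2 int3 by auto
  then have "(\<integral>\<^sup>+s. ennreal ((norm (W s - m))\<^sup>2) \<partial>M) = ennreal (\<integral>s. (norm (W s - m))\<^sup>2 \<partial>M)"
    by (intro nn_integral_eq_integral) auto
  also have "(\<integral>s. (norm (W s - m))\<^sup>2 \<partial>M) = (\<integral>s. (norm (W s))\<^sup>2 \<partial>M) - (norm m)\<^sup>2"
    using int2 int3 by (simp add: eq prob_space)
  finally have "(\<integral>\<^sup>+s. ennreal ((norm (W s - m))\<^sup>2) \<partial>M)
      = ennreal ((\<integral>s. (norm (W s))\<^sup>2 \<partial>M) - (norm m)\<^sup>2)" .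
  moreover have "(\<integral>s. (norm (W s))\<^sup>2 \<partial>M) - (norm m)\<^sup>2 \<le> c\<^sup>2"
  proof -
    have "(\<integral>s. (norm (W s))\<^sup>2 \<partial>M) \<le> (\<integral>s. c\<^sup>2 \<partial>M)"
      by (intro integral_mono int2 c2) auto
    then have "(\<integral>s. (norm (W s))\<^sup>2 \<partial>M) \<le> c\<^sup>2" by (simp add: prob_space)
    moreover have "0 \<le> (norm m)\<^sup>2" by simp
    ultimately show ?thesis by linarith
  qed
  ultimately show ?thesis by (simp add: m_def ennreal_leI)
qed

section \<open>Error propagation along a run\<close>

text \<open>Every increment \<open>B j\<close> enters at most \<open>q\<close> of the bounds on the \<open>A t\<close>.\<close>
lemma sum_epochs_le:
  fixes A B :: "nat \<Rightarrow> real"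
  assumes q: "q > 0" and c: "0 \<le> c" and B: "\<And>t. 0 \<le> B t"
    and start: "\<And>t. t < T \<Longrightarrow> q dvd t \<Longrightarrow> A t \<le> s"
    and step: "\<And>t. Suc t < T \<Longrightarrow> \<not> q dvd Suc t \<Longrightarrow> A (Suc t) \<le> A t + c / real q * B t"
  shows "(\<Sum>t<T. A t) \<le> real T * s + c * (\<Sum>t<T. B t)"
proof -
  \<comment> \<open>The steps before \<open>t\<close> in the epoch of \<open>t\<close>; empty at a
    refresh.\<close>
  let ?I = "\<lambda>t. {t - t mod q..<t}"
  have A: "A t \<le> s + c / real q * (\<Sum>j\<in>?I t. B j)" if "t < T" for t
    using that
  proof (induction t)
    case 0
    then show ?case using start[of 0] by simp
  next
    case (Suc t)
    show ?case
    proof (cases "q dvd Suc t")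
      case True
      then show ?thesis using start[of "Suc t"] Suc.prems by (simp add: dvd_eq_mod_eq_0)
    next
      case False
      then have "Suc t mod q = Suc (t mod q)"
        by (metis dvd_eq_mod_eq_0 mod_Suc)
      then have "?I (Suc t) = insert t (?I t)" by auto
      then have "(\<Sum>j\<in>?I (Suc t). B j) = (\<Sum>j\<in>?I t. B j) + B t" by simp
      then show ?thesis
        using step[OF Suc.prems False] Suc by (simp add: distrib_left)
    qed
  qed
  \<comment> \<open>The epoch window is enlarged to a condition that no longer mentions the position
    of refreshes. The double sum can then be exchanged, and each \<open>j\<close> meets at most the
    \<open>q\<close> indices in \<open>{j<..j + q}\<close>.\<close>
  have "(\<Sum>t<T. \<Sum>j\<in>?I t. B j) \<le> (\<Sum>t<T. \<Sum>j<T. if j < t \<and> t \<le> j + q then B j else 0)"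
  proof (rule sum_mono)
    fix t assume "t \<in> {..<T}"
    then have "?I t \<subseteq> {j\<in>{..<T}. j < t \<and> t \<le> j + q}"
      using mod_less_divisor[OF q, of t] by auto
    then have "(\<Sum>j\<in>?I t. B j) \<le> (\<Sum>j\<in>{j\<in>{..<T}. j < t \<and> t \<le> j + q}. B j)"
      by (intro sum_mono2) (auto simp: B)
    also have "\<dots> = (\<Sum>j<T. if j < t \<and> t \<le> j + q then B j else 0)"
      by (rule sum.inter_filter) simp
    finally show "(\<Sum>j\<in>?I t. B j) \<le> (\<Sum>j<T. if j < t \<and> t \<le> j + q then B j else 0)" .
  qed
  also have "\<dots> = (\<Sum>j<T. \<Sum>t<T. if j < t \<and> t \<le> j + q then B j else 0)"
    by (rule sum.swap)
  also have "\<dots> \<le> (\<Sum>j<T. real q * B j)"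
  proof (rule sum_mono)
    fix j
    have "(\<Sum>t<T. if j < t \<and> t \<le> j + q then B j else 0) = (\<Sum>t\<in>{t\<in>{..<T}. j < t \<and> t \<le> j + q}. B j)"
      by (rule sum.inter_filter[symmetric]) simp
    also have "\<dots> = real (card {t\<in>{..<T}. j < t \<and> t \<le> j + q}) * B j"
      by simp
    also have "card {t\<in>{..<T}. j < t \<and> t \<le> j + q} \<le> card {j<..j + q}"
      by (intro card_mono) auto
    then have "real (card {t\<in>{..<T}. j < t \<and> t \<le> j + q}) * B j \<le> real q * B j"
      by (intro mult_right_mono B) simp
    finally show "(\<Sum>t<T. if j < t \<and> t \<le> j + q then B j else 0) \<le> real q * B j" .
  qed
  finally have "(\<Sum>t<T. \<Sum>j\<in>?I t. B j) \<le> real q * (\<Sum>j<T. B j)" by (simp add: sum_distrib_left)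
  then have "c / real q * (\<Sum>t<T. \<Sum>j\<in>?I t. B j) \<le> c / real q * (real q * (\<Sum>j<T. B j))"
    using c by (intro mult_left_mono) auto
  moreover have "(\<Sum>t<T. A t) \<le> (\<Sum>t<T. s + c / real q * (\<Sum>j\<in>?I t. B j))"
    by (intro sum_mono A) auto
  moreover have "(\<Sum>t<T. s + c / real q * (\<Sum>j\<in>?I t. B j)) = real T * s + c / real q * (\<Sum>t<T. \<Sum>j\<in>?I t. B j)"
    by (simp only: sum.distrib sum_distrib_left[symmetric]) simp
  moreover have "c / real q * (real q * (\<Sum>j<T. B j)) = c * (\<Sum>j<T. B j)"
    using q by simp
  ultimately show ?thesis by linarith
qed

section \<open>Consequences of the problem assumptions\<close>

context composite_problem
begin

abbreviation "grad \<equiv> gradient (expected_loss D f)"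
abbreviation "\<Phi> y \<equiv> expected_loss D f y + real_of_ereal (r y)"

lemma GDERIV_expected_loss: "GDERIV (expected_loss D f) y :> grad y"
  by (rule gderiv_gradient) (rule loss_differentiable)

lemma grad_measurable[measurable]: "grad \<in> borel_measurable borel"
  by (rule borel_measurable_continuous_onI) (rule lipschitz_on_continuous_on[OF loss_smooth])

text \<open>Measurable in the sample and Lipschitz in the point, the sample gradient is a
  Caratheodory function, so both arguments may be random.\<close>

lemma sample_gradient_measurable:
  assumes "Z \<in> measurable N D" "X \<in> borel_measurable N"
  shows "(\<lambda>\<omega>. sample_gradient f (Z \<omega>) (X \<omega>)) \<in> borel_measurable N"
proof (rule borel_measurable_Caratheodory[OF _ _ assms])
  show "(\<lambda>s. sample_gradient f s a) \<in> borel_measurable D" for a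
    by (rule borel_measurable_integrable) (rule gradient_integrable)
  show "continuous_on UNIV (sample_gradient f s)" if "s \<in> space D" for s
    using sample_smooth[OF that] by (rule lipschitz_on_continuous_on)
qed

text \<open>The minimizer has a finite value, by comparison with a point where \<open>r\<close> is
  finite. An infinite value at \<open>x0\<close> would therefore make the initial gap
  infinite.\<close>

lemma initial_finite: "\<bar>r x0\<bar> \<noteq> \<infinity>"
  and initial_gap_le: "\<bar>r y\<bar> \<noteq> \<infinity> \<Longrightarrow> \<Phi> x0 - \<Phi> y \<le> \<Delta>"
proof -
  obtain xs where min: "\<And>y. \<not> objective D f r y < objective D f r xs"
      and gap: "objective D f r x0 - objective D f r xs \<le> ereal \<Delta>"
    using initial_gap by (auto simp: is_arg_min_def)
  have nm: "r y \<noteq> -\<infinity>" for y using r_proper by (auto simp: proper_fun_def)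
  obtain y0 where "r y0 \<noteq> \<infinity>" using r_proper by (auto simp: proper_fun_def)
  then have "r xs \<noteq> \<infinity>" using min[of y0] by (auto simp: objective_def)
  then obtain \<rho> where xs: "r xs = ereal \<rho>" using nm[of xs] by (cases "r xs") auto
  show x0: "\<bar>r x0\<bar> \<noteq> \<infinity>"
    using gap nm[of x0] by (cases "r x0") (auto simp: objective_def xs)
  show "\<Phi> x0 - \<Phi> y \<le> \<Delta>" if "\<bar>r y\<bar> \<noteq> \<infinity>"
    using that x0 gap min[of y] by (cases "r x0"; cases "r y") (auto simp: objective_def xs)
qed

text \<open>Both gradients use the same sample, so their difference is bounded by
  \<open>L * norm (a - b)\<close> for every sample. This is why a recursive step pays for the
  distance moved instead of for \<open>\<sigma>\<close>.\<close>

lemma gradient_difference_variance: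
  "(\<integral>\<^sup>+s. ennreal ((norm (sample_gradient f s a - sample_gradient f s b - (grad a - grad b)))\<^sup>2) \<partial>D)
     \<le> ennreal (L\<^sup>2 * (norm (a - b))\<^sup>2)"
proof -
  have "(\<integral>s. sample_gradient f s a - sample_gradient f s b \<partial>D) = grad a - grad b"
    by (simp add: gradient_integrable gradient_unbiased)
  moreover have "(\<integral>\<^sup>+s. ennreal ((norm (sample_gradient f s a - sample_gradient f s b
        - (\<integral>s. sample_gradient f s a - sample_gradient f s b \<partial>D)))\<^sup>2) \<partial>D) \<le> ennreal ((L * norm (a - b))\<^sup>2)"
    using lipschitz_onD[OF sample_smooth]
    by (intro nn_integral_norm_centered borel_measurable_diff borel_measurable_integrable gradient_integrable)
      (auto simp: dist_norm)
  ultimately show ?thesis by (simp add: power_mult_distrib)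
qed

end

text \<open>Of the parameter choices only the step size bound and \<open>b2 = q\<close> enter here,
  so both settings share the analysis; they differ through \<open>refresh_variance\<close> alone
  once the errors are bounded.\<close>

locale spgr_analysis =
  problem: composite_problem D f r x0 L \<sigma> \<Delta> +
  run: spgr_run D f r x0 \<eta> S T q b1 b2 M \<xi> x g R
  for D :: "'s measure" and f :: "real ^ 'd \<Rightarrow> 's \<Rightarrow> real" and r :: "real ^ 'd \<Rightarrow> ereal"
    and x0 :: "real ^ 'd" and L \<sigma> \<Delta> \<eta> :: real and S :: setting and T q b1 b2 :: nat
    and M :: "'w measure" and \<xi> :: "nat \<Rightarrow> nat \<Rightarrow> 'w \<Rightarrow> 's" and x g :: "nat \<Rightarrow> 'w \<Rightarrow> real ^ 'd"
    and R :: "'w \<Rightarrow> nat" +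
  assumes \<eta>: "\<eta> > 0" and \<eta>L: "\<eta> * L < 1 / 3" and b2: "b2 = q"
begin

abbreviation "grad \<equiv> gradient (expected_loss D f)"
abbreviation "k \<equiv> draws S q b1 b2"
abbreviation "H t \<equiv> history k \<xi> x t"
abbreviation HS :: "nat \<Rightarrow> ((nat \<Rightarrow> real ^ 'd) \<times> (nat \<times> nat \<Rightarrow> 's)) measure" where
  "HS t \<equiv> history_space D k t"
abbreviation "batch_law t \<equiv> \<Pi>\<^sub>M i\<in>{..<k t}. D"
abbreviation "batch t \<omega> \<equiv> \<lambda>i\<in>{..<k t}. \<xi> t i \<omega>"

definition "e t \<omega> = g t \<omega> - grad (x t \<omega>)"
definition "d t \<omega> = x (Suc t) \<omega> - x t \<omega>"
definition "v t \<omega> = grad (x (Suc t) \<omega>) - g t \<omega> - (1 / \<eta>) *\<^sub>R d t \<omega>"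
definition "refresh_variance = (case S of Online \<Rightarrow> \<sigma>\<^sup>2 / real b1 | Finite_Sum \<Rightarrow> 0)"

text \<open>The estimators as functions of the history: what is measurable in the history of a step is
  independent of the batch drawn there.\<close>
definition refresh_estimator :: "nat \<Rightarrow> (nat \<Rightarrow> real ^ 'd) \<times> (nat \<times> nat \<Rightarrow> 's) \<Rightarrow> real ^ 'd" where
  "refresh_estimator t h = (case S of
     Online \<Rightarrow> batch_gradient f b1 (\<lambda>i. snd h (t, i)) (fst h t)
   | Finite_Sum \<Rightarrow> grad (fst h t))"

primrec estimator :: "nat \<Rightarrow> (nat \<Rightarrow> real ^ 'd) \<times> (nat \<times> nat \<Rightarrow> 's) \<Rightarrow> real ^ 'd" where
  "estimator 0 h = refresh_estimator 0 h"
| "estimator (Suc t) h = (if q dvd Suc t then refresh_estimator (Suc t) h else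
     batch_gradient f b2 (\<lambda>i. snd h (Suc t, i)) (fst h (Suc t))
     - batch_gradient f b2 (\<lambda>i. snd h (Suc t, i)) (fst h t) + estimator t h)"

section \<open>Estimators as measurable functions of the history\<close>

lemma draws_refresh: "S = Online \<Longrightarrow> q dvd t \<Longrightarrow> b1 = k t"
  and draws_recursion: "\<not> q dvd t \<Longrightarrow> b2 = k t"
  by (simp_all add: draws_def)

lemma history_point_measurable[measurable]:
  "s \<le> n \<Longrightarrow> (\<lambda>h. fst h s) \<in> borel_measurable (HS n)"
  unfolding history_space_def
  by (rule measurable_compose[OF measurable_fst measurable_component_singleton]) simp

lemma history_sample_measurable:
  "t < n \<Longrightarrow> i < k t \<Longrightarrow> (\<lambda>h. snd h (t, i)) \<in> measurable (HS n) D"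
  unfolding history_space_def
  by (rule measurable_compose[OF measurable_snd measurable_component_singleton]) simp

lemma batch_gradient_history_measurable:
  assumes "t < n" "b = k t" "s \<le> n"
  shows "(\<lambda>h. batch_gradient f b (\<lambda>i. snd h (t, i)) (fst h s)) \<in> borel_measurable (HS n)"
  unfolding batch_gradient_def using assms
  by (intro borel_measurable_scaleR borel_measurable_sum borel_measurable_const
      problem.sample_gradient_measurable history_sample_measurable history_point_measurable) auto

lemma refresh_estimator_measurable:
  assumes "t < n" "q dvd t"
  shows "refresh_estimator t \<in> borel_measurable (HS n)"
proof (cases "S = Online")
  case True
  then have "refresh_estimator t = (\<lambda>h. batch_gradient f b1 (\<lambda>i. snd h (t, i)) (fst h t))"
    unfolding refresh_estimator_def fun_eq_iff by simp
  then show ?thesis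
    using batch_gradient_history_measurable[OF assms(1) draws_refresh[OF True assms(2)], of t] assms(1) by (simp only: order_less_imp_le)
next
  case False
  then have "refresh_estimator t = (\<lambda>h. grad (fst h t))"
    unfolding refresh_estimator_def fun_eq_iff by (simp split: setting.split)
  then show ?thesis
    using measurable_compose[OF history_point_measurable problem.grad_measurable, of t n] assms(1) by simp
qed

text \<open>The strict inequality matters: the samples drawn at step \<open>t\<close> belong to the
  history only from index \<open>Suc t\<close> on.\<close>

lemma estimator_measurable:
  "t < n \<Longrightarrow> estimator t \<in> borel_measurable (HS n)"
proof (induction t)
  case 0
  then show ?case using refresh_estimator_measurable[of 0 n] by (simp add: estimator.simps[abs_def])
next
  case (Suc t)
  show ?case
  proof (cases "q dvd Suc t")
    case True
    then show ?thesis using refresh_estimator_measurable[of "Suc t" n] Suc.prems by simp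
  next
    case False
    then show ?thesis
      using Suc batch_gradient_history_measurable[of "Suc t" n b2 "Suc t"]
        batch_gradient_history_measurable[of "Suc t" n b2 t] draws_recursion[OF False]
      by simp
  qed
qed

lemma history_point: "s \<le> n \<Longrightarrow> fst (H n \<omega>) s = x s \<omega>"
  by (simp add: history_def)

lemma history_sample: "t < n \<Longrightarrow> i < k t \<Longrightarrow> snd (H n \<omega>) (t, i) = \<xi> t i \<omega>"
  by (simp add: history_def)

lemma batch_gradient_history:
  "t < n \<Longrightarrow> b = k t \<Longrightarrow> batch_gradient f b (\<lambda>i. snd (H n \<omega>) (t, i)) y = batch_gradient f b (\<lambda>i. \<xi> t i \<omega>) y"
  by (auto simp: batch_gradient_def history_sample)

lemma refresh_estimator_history:
  assumes "t < n" "n \<le> T" "q dvd t" "\<omega> \<in> space M"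
  shows "refresh_estimator t (H n \<omega>) = g t \<omega>"
proof -
  have x: "fst (H n \<omega>) t = x t \<omega>" using assms(1) by (simp add: history_point)
  have batch: "batch_gradient f b1 (\<lambda>i. snd (H n \<omega>) (t, i)) y = batch_gradient f b1 (\<lambda>i. \<xi> t i \<omega>) y"
    if "S = Online" for y
    by (rule batch_gradient_history[OF assms(1) draws_refresh[OF that assms(3)]])
  have "g t \<omega> = (case S of Online \<Rightarrow> batch_gradient f b1 (\<lambda>i. \<xi> t i \<omega>) (x t \<omega>) | Finite_Sum \<Rightarrow> grad (x t \<omega>))"
    using assms by (intro run.refresh) auto
  then show ?thesis
    unfolding refresh_estimator_def x using batch by (cases S) simp_all
qed

lemma estimator_history:
  assumes "t < n" "n \<le> T" "\<omega> \<in> space M"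
  shows "estimator t (H n \<omega>) = g t \<omega>"
  using assms
proof (induction t)
  case 0
  then show ?case by (simp add: refresh_estimator_history)
next
  case (Suc t)
  then show ?case
    using run.recursion[of "Suc t" \<omega>] batch_gradient_history[of "Suc t" n b2 \<omega>] draws_recursion[of "Suc t"]
    by (auto simp: refresh_estimator_history history_point)
qed

lemma history_measurable: "t < T \<Longrightarrow> H t \<in> measurable M (HS t)"
  using run.batch_fresh[of t] by (simp add: run.indep_pair_def)

lemma final_history_measurable: "H T \<in> measurable M (HS T)"
  using run.output_indep by (simp add: run.indep_pair_def)

text \<open>Measurability of \<open>g t\<close> is inherited from the final history, on which it
  depends through \<open>estimator t\<close>.\<close>

lemma estimate_measurable[measurable]:
  assumes "t < T" shows "g t \<in> borel_measurable M"
proof -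
  have "(\<lambda>\<omega>. estimator t (H T \<omega>)) \<in> borel_measurable M"
    using final_history_measurable estimator_measurable[OF assms] by (rule measurable_compose)
  then show ?thesis
    by (rule measurable_cong[THEN iffD1, rotated]) (simp add: estimator_history assms)
qed

lemma error_measurable[measurable]: "t < T \<Longrightarrow> e t \<in> borel_measurable M"
  unfolding e_def[abs_def]
  by (intro borel_measurable_diff measurable_compose[OF _ problem.grad_measurable]
      estimate_measurable run.iterates_measurable) auto

lemma move_measurable[measurable]: "t < T \<Longrightarrow> d t \<in> borel_measurable M"
  unfolding d_def[abs_def] by (intro borel_measurable_diff run.iterates_measurable) auto

text \<open>Independence within the batch together with the common law \<open>D\<close>.
  \<open>pos\<close> excludes the empty batch, which occurs only at a refresh with the full data
  set.\<close>

lemma batch_distr: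
  assumes t: "t < T" and pos: "k t > 0"
  shows "distr M (batch_law t) (batch t) = batch_law t"
proof -
  have "distr M (batch_law t) (batch t) = (\<Pi>\<^sub>M i\<in>{..<k t}. distr M D (\<xi> t i))"
    using run.batch_indep[OF t] pos run.samples_measurable[OF t]
    by (subst (asm) run.indep_vars_iff_distr_eq_PiM') auto
  also have "\<dots> = batch_law t"
    by (intro PiM_cong refl run.samples_law t) auto
  finally show ?thesis .
qed

section \<open>Mean-square error of the estimators\<close>

lemma refresh_error:
  assumes t: "t < T" and dvd: "q dvd t"
  shows "(\<integral>\<^sup>+\<omega>. ennreal ((norm (e t \<omega>))\<^sup>2) \<partial>M) \<le> ennreal refresh_variance"
proof (cases S)
  case Finite_Sum
  then have "e t \<omega> = 0" if "\<omega> \<in> space M" for \<omega>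
    using run.refresh[OF t dvd that] by (simp add: e_def)
  then have "(\<integral>\<^sup>+\<omega>. ennreal ((norm (e t \<omega>))\<^sup>2) \<partial>M) = (\<integral>\<^sup>+\<omega>. 0 \<partial>M)"
    by (intro nn_integral_cong) simp
  then show ?thesis by simp
next
  case Online
  have kt: "k t = b1" using dvd Online by (simp add: draws_def)
  have b1: "b1 > 0" by (rule run.params_pos)
  have rv: "refresh_variance = \<sigma>\<^sup>2 / real (k t)"
    unfolding refresh_variance_def kt using Online by simp
  \<comment> \<open>Centred sample gradient at the current iterate, read off the history. A refresh
    forgets the earlier error, so the shift in the fresh-batch estimate is 0.\<close>
  define Y where "Y = (\<lambda>(h :: (nat \<Rightarrow> real ^ 'd) \<times> (nat \<times> nat \<Rightarrow> 's)) s. sample_gradient f s (fst h t) - grad (fst h t))"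
  have "(\<integral>\<^sup>+\<omega>. ennreal ((norm (0 + (1 / real (k t)) *\<^sub>R (\<Sum>i<k t. Y (H t \<omega>) (batch t \<omega> i))))\<^sup>2) \<partial>M)
      \<le> (\<integral>\<^sup>+\<omega>. ennreal ((norm (0 :: real ^ 'd))\<^sup>2 + \<sigma>\<^sup>2 / real (k t)) \<partial>M)"
  proof (rule run.nn_integral_norm_mean_fresh[where D=D and N="HS t" and X="H t" and Z="batch t" and e="\<lambda>_. 0"
        and Y=Y and V="\<lambda>_. \<sigma>\<^sup>2"])
    show "prob_space D" by (rule problem.prob_space_axioms)
    show "run.indep_pair (HS t) (H t) (batch_law t) (batch t)" by (rule run.batch_fresh[OF t])
    show "distr M (batch_law t) (batch t) = batch_law t" using batch_distr[OF t] kt b1 by simp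
    have "(\<lambda>p. fst (fst p) t) \<in> borel_measurable (HS t \<Otimes>\<^sub>M D)"
      by (rule measurable_compose[OF measurable_fst history_point_measurable]) simp
    then show "(\<lambda>(h, s). Y h s) \<in> borel_measurable (HS t \<Otimes>\<^sub>M D)"
      unfolding Y_def split_beta
      by (intro borel_measurable_diff problem.sample_gradient_measurable measurable_snd
          measurable_compose[OF _ problem.grad_measurable])
    show "integrable D (Y h)" for h
      unfolding Y_def by (simp add: problem.gradient_integrable)
    show "(\<integral>s. Y h s \<partial>D) = 0" for h
      unfolding Y_def by (simp add: problem.gradient_integrable problem.gradient_unbiased problem.prob_space)
    show "(\<integral>\<^sup>+s. ennreal ((norm (Y h s))\<^sup>2) \<partial>D) \<le> ennreal (\<sigma>\<^sup>2)" for h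
      unfolding Y_def by (rule problem.gradient_variance)
  qed (use kt b1 in auto)
  also have "(\<integral>\<^sup>+\<omega>. ennreal ((norm (0 :: real ^ 'd))\<^sup>2 + \<sigma>\<^sup>2 / real (k t)) \<partial>M) = ennreal refresh_variance"
    by (simp add: run.emeasure_space_1 rv)
  also have "(\<integral>\<^sup>+\<omega>. ennreal ((norm (0 + (1 / real (k t)) *\<^sub>R (\<Sum>i<k t. Y (H t \<omega>) (batch t \<omega> i))))\<^sup>2) \<partial>M)
      = (\<integral>\<^sup>+\<omega>. ennreal ((norm (e t \<omega>))\<^sup>2) \<partial>M)"
  proof (rule nn_integral_cong)
    fix \<omega> assume \<omega>: "\<omega> \<in> space M"
    have "g t \<omega> = batch_gradient f b1 (\<lambda>i. \<xi> t i \<omega>) (x t \<omega>)"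
      using run.refresh[OF t dvd \<omega>] Online by simp
    \<comment> \<open>A mean over a nonempty batch leaves the constant
      \<open>grad (x t \<omega>)\<close> unchanged, so it may be subtracted sample by
      sample.\<close>
    then have "0 + (1 / real (k t)) *\<^sub>R (\<Sum>i<k t. Y (H t \<omega>) (batch t \<omega> i)) = e t \<omega>"
      using b1
      by (simp add: e_def batch_gradient_def kt Y_def history_point sum_subtractf sum_constant_scaleR
          scaleR_diff_right del: sum_constant)
    then show "ennreal ((norm (0 + (1 / real (k t)) *\<^sub>R (\<Sum>i<k t. Y (H t \<omega>) (batch t \<omega> i))))\<^sup>2)
        = ennreal ((norm (e t \<omega>))\<^sup>2)" by simp
  qed
  finally show ?thesis .
qed

text \<open>The martingale step. \<open>e (Suc t)\<close> is \<open>e t\<close> plus a mean of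
  centred gradient differences. The old error and both evaluation points are functions of the
  history at \<open>Suc t\<close>, which is independent of the new batch, so the fresh-batch
  estimate applies with the old error as shift.\<close>

lemma recursive_error:
  assumes t: "Suc t < T" and ndvd: "\<not> q dvd Suc t"
  shows "(\<integral>\<^sup>+\<omega>. ennreal ((norm (e (Suc t) \<omega>))\<^sup>2) \<partial>M)
     \<le> (\<integral>\<^sup>+\<omega>. ennreal ((norm (e t \<omega>))\<^sup>2 + L\<^sup>2 * (norm (d t \<omega>))\<^sup>2 / real b2) \<partial>M)"
proof -
  let ?t = "Suc t"
  have kt: "k ?t = b2" using ndvd by (simp add: draws_def)
  have b2: "b2 > 0" by (rule run.params_pos)
  define Y where "Y = (\<lambda>(h :: (nat \<Rightarrow> real ^ 'd) \<times> (nat \<times> nat \<Rightarrow> 's)) s.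
      sample_gradient f s (fst h ?t) - sample_gradient f s (fst h t) - (grad (fst h ?t) - grad (fst h t)))"
  define V where "V = (\<lambda>(h :: (nat \<Rightarrow> real ^ 'd) \<times> (nat \<times> nat \<Rightarrow> 's)).
      L\<^sup>2 * (norm (fst h ?t - fst h t))\<^sup>2)"
  define E where "E = (\<lambda>h. estimator t h - grad (fst h t))"
  have pm: "(\<lambda>h. fst h ?t) \<in> borel_measurable (HS ?t)" "(\<lambda>h. fst h t) \<in> borel_measurable (HS ?t)"
    by (auto intro: history_point_measurable)
  have "(\<integral>\<^sup>+\<omega>. ennreal ((norm (E (H ?t \<omega>) + (1 / real (k ?t)) *\<^sub>R (\<Sum>i<k ?t. Y (H ?t \<omega>) (batch ?t \<omega> i))))\<^sup>2) \<partial>M)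
      \<le> (\<integral>\<^sup>+\<omega>. ennreal ((norm (E (H ?t \<omega>)))\<^sup>2 + V (H ?t \<omega>) / real (k ?t)) \<partial>M)"
  proof (rule run.nn_integral_norm_mean_fresh[where D=D and N="HS ?t" and X="H ?t" and Z="batch ?t" and e=E
        and Y=Y and V=V])
    show "prob_space D" by (rule problem.prob_space_axioms)
    show "run.indep_pair (HS ?t) (H ?t) (batch_law ?t) (batch ?t)" by (rule run.batch_fresh[OF t])
    show "distr M (batch_law ?t) (batch ?t) = batch_law ?t" using batch_distr[OF t] kt b2 by simp
    show "E \<in> borel_measurable (HS ?t)"
      unfolding E_def by (intro borel_measurable_diff estimator_measurable
          measurable_compose[OF _ problem.grad_measurable] pm) simp
    show "V \<in> borel_measurable (HS ?t)"
      unfolding V_def by (intro borel_measurable_times borel_measurable_power borel_measurable_const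
          measurable_compose[OF _ borel_measurable_norm] borel_measurable_diff pm)
    show "(\<lambda>(h, s). Y h s) \<in> borel_measurable (HS ?t \<Otimes>\<^sub>M D)"
      unfolding Y_def split_beta
      by (intro borel_measurable_diff problem.sample_gradient_measurable measurable_snd
          measurable_compose[OF _ problem.grad_measurable] measurable_compose[OF measurable_fst] pm)
    show "integrable D (Y h)" for h
      unfolding Y_def by (simp add: problem.gradient_integrable)
    show "(\<integral>s. Y h s \<partial>D) = 0" for h
      unfolding Y_def by (simp add: problem.gradient_integrable problem.gradient_unbiased problem.prob_space)
    show "(\<integral>\<^sup>+s. ennreal ((norm (Y h s))\<^sup>2) \<partial>D) \<le> ennreal (V h)" for h
      unfolding Y_def V_def by (rule problem.gradient_difference_variance)
  qed (use kt b2 in \<open>auto simp: V_def\<close>)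
  also have "(\<integral>\<^sup>+\<omega>. ennreal ((norm (E (H ?t \<omega>)))\<^sup>2 + V (H ?t \<omega>) / real (k ?t)) \<partial>M)
      = (\<integral>\<^sup>+\<omega>. ennreal ((norm (e t \<omega>))\<^sup>2 + L\<^sup>2 * (norm (d t \<omega>))\<^sup>2 / real b2) \<partial>M)"
    using t by (intro nn_integral_cong) (simp add: E_def V_def e_def d_def history_point estimator_history kt)
  also have "(\<integral>\<^sup>+\<omega>. ennreal ((norm (E (H ?t \<omega>) + (1 / real (k ?t)) *\<^sub>R (\<Sum>i<k ?t. Y (H ?t \<omega>) (batch ?t \<omega> i))))\<^sup>2) \<partial>M)
      = (\<integral>\<^sup>+\<omega>. ennreal ((norm (e ?t \<omega>))\<^sup>2) \<partial>M)"
  proof (rule nn_integral_cong)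
    fix \<omega> assume \<omega>: "\<omega> \<in> space M"
    have "E (H ?t \<omega>) + (1 / real (k ?t)) *\<^sub>R (\<Sum>i<k ?t. Y (H ?t \<omega>) (batch ?t \<omega> i)) = e ?t \<omega>"
      using run.recursion[OF t ndvd \<omega>] b2 t \<omega>
      by (simp add: e_def E_def batch_gradient_def kt Y_def history_point estimator_history sum_subtractf
          sum_constant_scaleR scaleR_diff_right del: sum_constant)
    then show "ennreal ((norm (E (H ?t \<omega>) + (1 / real (k ?t)) *\<^sub>R (\<Sum>i<k ?t. Y (H ?t \<omega>) (batch ?t \<omega> i))))\<^sup>2)
        = ennreal ((norm (e ?t \<omega>))\<^sup>2)" by simp
  qed
  finally show ?thesis .
qed

section \<open>Pathwise bounds from the proximal steps\<close>

lemma L_pos: "L > 0" by (rule problem.L_pos)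

lemma iterate_finite: "t \<le> T \<Longrightarrow> \<omega> \<in> space M \<Longrightarrow> \<bar>r (x t \<omega>)\<bar> \<noteq> \<infinity>"
  using prox_finite[OF problem.r_proper run.prox_step] problem.initial_finite
  by (cases t) (simp_all add: run.initial)

lemma prox_gradient_step:
  assumes "t < T" "\<omega> \<in> space M"
  shows "prox_gradient_step (expected_loss D f) grad r L \<eta> (x t \<omega>) (g t \<omega>) (x (Suc t) \<omega>)"
  using assms \<eta> L_pos iterate_finite[of t \<omega>]
  by unfold_locales
    (auto intro: problem.GDERIV_expected_loss problem.loss_smooth problem.r_proper run.prox_step)

lemma sum_descent:
  assumes "n \<le> T" "\<omega> \<in> space M"
  shows "(\<Sum>t<n. problem.\<Phi> (x t \<omega>) - problem.\<Phi> (x (Suc t) \<omega>)) \<le> \<Delta>"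
  using sum_lessThan_telescope'[of "\<lambda>t. problem.\<Phi> (x t \<omega>)" n] problem.initial_gap_le[OF iterate_finite[OF assms]] run.initial[OF assms(2)] by simp

text \<open>Stated for every initial segment \<open>n\<close>, since the square integrability of a
  single move is derived from the errors up to that time only.\<close>

lemma sum_moves_le:
  assumes n: "n \<le> T" and \<omega>: "\<omega> \<in> space M"
  shows "(1 / (2 * \<eta>) - L) * (\<Sum>t<n. (norm (d t \<omega>))\<^sup>2) \<le> \<Delta> + (\<Sum>t<n. (norm (e t \<omega>))\<^sup>2) / (2 * L)"
proof -
  have "(\<Sum>t<n. (1 / (2 * \<eta>) - L) * (norm (d t \<omega>))\<^sup>2)
     \<le> (\<Sum>t<n. (problem.\<Phi> (x t \<omega>) - problem.\<Phi> (x (Suc t) \<omega>)) + (norm (e t \<omega>))\<^sup>2 / (2 * L))"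
  proof (rule sum_mono)
    fix t assume "t \<in> {..<n}"
    then interpret prox_gradient_step "expected_loss D f" grad r L \<eta> "x t \<omega>" "g t \<omega>" "x (Suc t) \<omega>"
      using n \<omega> by (intro prox_gradient_step) auto
    show "(1 / (2 * \<eta>) - L) * (norm (d t \<omega>))\<^sup>2
        \<le> (problem.\<Phi> (x t \<omega>) - problem.\<Phi> (x (Suc t) \<omega>)) + (norm (e t \<omega>))\<^sup>2 / (2 * L)"
      using descent by (simp add: d_def e_def)
  qed
  then show ?thesis
    using sum_descent[OF assms]
    unfolding sum.distrib sum_distrib_left[symmetric] sum_divide_distrib[symmetric] by linarith
qed

lemma sum_residuals_le:
  assumes \<omega>: "\<omega> \<in> space M"
  shows "(\<Sum>t<T. (norm (v t \<omega>))\<^sup>2)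
     \<le> 2 * (\<Sum>t<T. (norm (e t \<omega>))\<^sup>2) + (2 * L\<^sup>2 + 3 * L / \<eta>) * (\<Sum>t<T. (norm (d t \<omega>))\<^sup>2) + 2 / \<eta> * \<Delta>"
proof -
  have "(\<Sum>t<T. (norm (v t \<omega>))\<^sup>2)
     \<le> (\<Sum>t<T. 2 * (norm (e t \<omega>))\<^sup>2 + (2 * L\<^sup>2 + 3 * L / \<eta>) * (norm (d t \<omega>))\<^sup>2
           + 2 / \<eta> * (problem.\<Phi> (x t \<omega>) - problem.\<Phi> (x (Suc t) \<omega>)))"
  proof (rule sum_mono)
    fix t assume "t \<in> {..<T}"
    then interpret prox_gradient_step "expected_loss D f" grad r L \<eta> "x t \<omega>" "g t \<omega>" "x (Suc t) \<omega>"
      using \<omega> by (intro prox_gradient_step) auto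
    show "(norm (v t \<omega>))\<^sup>2 \<le> 2 * (norm (e t \<omega>))\<^sup>2 + (2 * L\<^sup>2 + 3 * L / \<eta>) * (norm (d t \<omega>))\<^sup>2
           + 2 / \<eta> * (problem.\<Phi> (x t \<omega>) - problem.\<Phi> (x (Suc t) \<omega>))"
      using stationarity by (simp add: v_def d_def e_def)
  qed
  moreover have "2 / \<eta> * (\<Sum>t<T. problem.\<Phi> (x t \<omega>) - problem.\<Phi> (x (Suc t) \<omega>)) \<le> 2 / \<eta> * \<Delta>"
    using \<eta> by (intro mult_left_mono sum_descent \<omega>) auto
  ultimately show ?thesis
    unfolding sum.distrib sum_distrib_left[symmetric] by linarith
qed

section \<open>Moments of errors and moves\<close>

lemma move_coefficient_pos: "1 / (2 * \<eta>) - L > 0"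
  using \<eta> \<eta>L by (simp add: field_simps)

lemma refresh_variance_nonneg: "0 \<le> refresh_variance"
  unfolding refresh_variance_def by (cases S) auto

text \<open>The two claims support each other. The error at \<open>t\<close> is square integrable by
  the refresh bound, or through \<open>recursive_error\<close> from error and move at the preceding
  step. The move at \<open>t\<close> is then dominated pathwise, via \<open>sum_moves_le\<close>, by
  the errors up to and including \<open>t\<close>.\<close>

lemma integrable_error_move:
  "t < T \<Longrightarrow> integrable M (\<lambda>\<omega>. (norm (e t \<omega>))\<^sup>2) \<and> integrable M (\<lambda>\<omega>. (norm (d t \<omega>))\<^sup>2)"
proof (induction t rule: less_induct)
  case (less t)
  note [measurable] = error_measurable[OF less.prems] move_measurable[OF less.prems]
  have E: "integrable M (\<lambda>\<omega>. (norm (e t \<omega>))\<^sup>2)"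
  proof (cases "q dvd t")
    case True
    have "(\<integral>\<^sup>+\<omega>. ennreal ((norm (e t \<omega>))\<^sup>2) \<partial>M) < \<infinity>"
      using refresh_error[OF less.prems True] by (rule le_less_trans) simp
    then show ?thesis by (intro integrableI_nonneg) auto
  next
    case False
    then obtain s where s: "t = Suc s" by (cases t) auto
    have "integrable M (\<lambda>\<omega>. (norm (e s \<omega>))\<^sup>2 + L\<^sup>2 * (norm (d s \<omega>))\<^sup>2 / real b2)"
      using less s by (intro Bochner_Integration.integrable_add integrable_divide integrable_mult_right) auto
    then have "(\<integral>\<^sup>+\<omega>. ennreal ((norm (e s \<omega>))\<^sup>2 + L\<^sup>2 * (norm (d s \<omega>))\<^sup>2 / real b2) \<partial>M) < \<infinity>"
      by (subst nn_integral_eq_integral) auto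
    with recursive_error[of s] less.prems False
    have "(\<integral>\<^sup>+\<omega>. ennreal ((norm (e t \<omega>))\<^sup>2) \<partial>M) < \<infinity>"
      unfolding s by (blast intro: le_less_trans)
    then show ?thesis by (intro integrableI_nonneg) auto
  qed
  moreover have "integrable M (\<lambda>\<omega>. (norm (d t \<omega>))\<^sup>2)"
  proof (rule Bochner_Integration.integrable_bound)
    show "integrable M (\<lambda>\<omega>. (\<Delta> + (\<Sum>s<Suc t. (norm (e s \<omega>))\<^sup>2) / (2 * L)) / (1 / (2 * \<eta>) - L))"
      using less E by (intro integrable_divide Bochner_Integration.integrable_add Bochner_Integration.integrable_sum)
        (auto simp: less_Suc_eq)
    have "(norm (d t \<omega>))\<^sup>2 \<le> (\<Delta> + (\<Sum>s<Suc t. (norm (e s \<omega>))\<^sup>2) / (2 * L)) / (1 / (2 * \<eta>) - L)"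
      if "\<omega> \<in> space M" for \<omega>
    proof -
      have "(norm (d t \<omega>))\<^sup>2 \<le> (\<Sum>s<Suc t. (norm (d s \<omega>))\<^sup>2)"
        by (rule member_le_sum) auto
      also have "\<dots> \<le> (\<Delta> + (\<Sum>s<Suc t. (norm (e s \<omega>))\<^sup>2) / (2 * L)) / (1 / (2 * \<eta>) - L)"
        using sum_moves_le[OF _ that, of "Suc t"] less.prems move_coefficient_pos
        by (simp add: pos_le_divide_eq mult.commute)
      finally show ?thesis .
    qed
    then show "AE \<omega> in M. norm ((norm (d t \<omega>))\<^sup>2)
        \<le> norm ((\<Delta> + (\<Sum>s<Suc t. (norm (e s \<omega>))\<^sup>2) / (2 * L)) / (1 / (2 * \<eta>) - L))"
      by (intro AE_I2) (smt (verit) real_norm_def zero_le_power2)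
  qed simp
  ultimately show ?case by simp
qed

lemma integrable_error: "t < T \<Longrightarrow> integrable M (\<lambda>\<omega>. (norm (e t \<omega>))\<^sup>2)"
  and integrable_move: "t < T \<Longrightarrow> integrable M (\<lambda>\<omega>. (norm (d t \<omega>))\<^sup>2)"
  using integrable_error_move by auto

text \<open>Here \<open>b2 = q\<close> takes effect: each move enters with weight
  \<open>L\<^sup>2 / q\<close> and is counted at most \<open>q\<close> times per epoch bound, so the
  epoch length disappears.\<close>

lemma sum_expected_errors_le:
  "(\<Sum>t<T. \<integral>\<omega>. (norm (e t \<omega>))\<^sup>2 \<partial>M) \<le> real T * refresh_variance + L\<^sup>2 * (\<Sum>t<T. \<integral>\<omega>. (norm (d t \<omega>))\<^sup>2 \<partial>M)"
proof (rule sum_epochs_le[where q=q])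
  show "q > 0" by (rule run.params_pos)
  fix t assume t: "t < T" "q dvd t"
  have "ennreal (\<integral>\<omega>. (norm (e t \<omega>))\<^sup>2 \<partial>M) = (\<integral>\<^sup>+\<omega>. ennreal ((norm (e t \<omega>))\<^sup>2) \<partial>M)"
    using integrable_error[OF t(1)] by (intro nn_integral_eq_integral[symmetric]) auto
  then show "(\<integral>\<omega>. (norm (e t \<omega>))\<^sup>2 \<partial>M) \<le> refresh_variance"
    using refresh_error[OF t] refresh_variance_nonneg by (metis ennreal_le_iff)
next
  fix t assume t: "Suc t < T" "\<not> q dvd Suc t"
  have int: "integrable M (\<lambda>\<omega>. (norm (e t \<omega>))\<^sup>2 + L\<^sup>2 * (norm (d t \<omega>))\<^sup>2 / real b2)"
    using t by (intro Bochner_Integration.integrable_add integrable_divide integrable_mult_right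
        integrable_error integrable_move) auto
  have "ennreal (\<integral>\<omega>. (norm (e (Suc t) \<omega>))\<^sup>2 \<partial>M) = (\<integral>\<^sup>+\<omega>. ennreal ((norm (e (Suc t) \<omega>))\<^sup>2) \<partial>M)"
    using integrable_error[OF t(1)] by (intro nn_integral_eq_integral[symmetric]) auto
  also note recursive_error[OF t]
  also have "(\<integral>\<^sup>+\<omega>. ennreal ((norm (e t \<omega>))\<^sup>2 + L\<^sup>2 * (norm (d t \<omega>))\<^sup>2 / real b2) \<partial>M)
      = ennreal (\<integral>\<omega>. (norm (e t \<omega>))\<^sup>2 + L\<^sup>2 * (norm (d t \<omega>))\<^sup>2 / real b2 \<partial>M)"
    using int by (intro nn_integral_eq_integral) auto
  finally have "(\<integral>\<omega>. (norm (e (Suc t) \<omega>))\<^sup>2 \<partial>M)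
      \<le> (\<integral>\<omega>. (norm (e t \<omega>))\<^sup>2 + L\<^sup>2 * (norm (d t \<omega>))\<^sup>2 / real b2 \<partial>M)"
    by (subst (asm) ennreal_le_iff) auto
  also have "\<dots> = (\<integral>\<omega>. (norm (e t \<omega>))\<^sup>2 \<partial>M) + L\<^sup>2 / real q * (\<integral>\<omega>. (norm (d t \<omega>))\<^sup>2 \<partial>M)"
    using t integrable_error[of t] integrable_move[of t] by (simp add: b2)
  finally show "(\<integral>\<omega>. (norm (e (Suc t) \<omega>))\<^sup>2 \<partial>M)
      \<le> (\<integral>\<omega>. (norm (e t \<omega>))\<^sup>2 \<partial>M) + L\<^sup>2 / real q * (\<integral>\<omega>. (norm (d t \<omega>))\<^sup>2 \<partial>M)" .
qed auto

text \<open>Inserting the error bound into the averaged descent inequality returns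
  \<open>L / 2\<close> times the sum of squared moves. Absorbed on the left, this leaves
  \<open>1 / (2 * \<eta>) - L - L / 2\<close>, which is the coefficient called
  \<open>\<theta>\<close>; its positivity is exactly \<open>\<eta> * L < 1 / 3\<close>.\<close>

lemma sum_expected_moves_le:
  "(1 - 3 * \<eta> * L) / (2 * \<eta>) * (\<Sum>t<T. \<integral>\<omega>. (norm (d t \<omega>))\<^sup>2 \<partial>M)
     \<le> \<Delta> + real T * refresh_variance / (2 * L)"
proof -
  let ?E = "\<Sum>t<T. \<integral>\<omega>. (norm (e t \<omega>))\<^sup>2 \<partial>M" and ?D = "\<Sum>t<T. \<integral>\<omega>. (norm (d t \<omega>))\<^sup>2 \<partial>M"
  have "(\<integral>\<omega>. (1 / (2 * \<eta>) - L) * (\<Sum>t<T. (norm (d t \<omega>))\<^sup>2) \<partial>M)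
     \<le> (\<integral>\<omega>. \<Delta> + (\<Sum>t<T. (norm (e t \<omega>))\<^sup>2) / (2 * L) \<partial>M)"
    by (intro integral_mono sum_moves_le integrable_mult_right Bochner_Integration.integrable_add integrable_divide
        Bochner_Integration.integrable_sum integrable_error integrable_move) auto
  moreover have "integrable M (\<lambda>\<omega>. (\<Sum>t<T. (norm (e t \<omega>))\<^sup>2) / (2 * L))"
    by (intro integrable_divide Bochner_Integration.integrable_sum integrable_error) auto
  ultimately have "(1 / (2 * \<eta>) - L) * ?D \<le> \<Delta> + ?E / (2 * L)"
    by (simp add: integrable_error integrable_move run.prob_space)
  also have "?E / (2 * L) \<le> (real T * refresh_variance + L\<^sup>2 * ?D) / (2 * L)"
    using L_pos sum_expected_errors_le by (intro divide_right_mono) auto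
  also have "\<dots> = real T * refresh_variance / (2 * L) + L / 2 * ?D"
    using L_pos by (simp add: field_simps power2_eq_square)
  finally have "(1 / (2 * \<eta>) - L) * ?D - L / 2 * ?D \<le> \<Delta> + real T * refresh_variance / (2 * L)" by simp
  moreover have "(1 / (2 * \<eta>) - L) * ?D - L / 2 * ?D = (1 - 3 * \<eta> * L) / (2 * \<eta>) * ?D"
    using \<eta> by (simp add: field_simps)
  ultimately show ?thesis by simp
qed

section \<open>Residuals and the random output\<close>

lemma residual_measurable[measurable]: "t < T \<Longrightarrow> v t \<in> borel_measurable M"
  unfolding v_def[abs_def]
  by (intro borel_measurable_diff borel_measurable_scaleR borel_measurable_const
      measurable_compose[OF _ problem.grad_measurable]
      estimate_measurable move_measurable run.iterates_measurable) auto

lemma integrable_residual_bound: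
  "integrable M (\<lambda>\<omega>. 2 * (\<Sum>t<T. (norm (e t \<omega>))\<^sup>2)
      + (2 * L\<^sup>2 + 3 * L / \<eta>) * (\<Sum>t<T. (norm (d t \<omega>))\<^sup>2) + 2 / \<eta> * \<Delta>)"
  by (intro integrable_mult_right Bochner_Integration.integrable_add
        Bochner_Integration.integrable_sum integrable_error integrable_move) auto

lemma integrable_residual:
  assumes t: "t < T" shows "integrable M (\<lambda>\<omega>. (norm (v t \<omega>))\<^sup>2)"
proof (rule Bochner_Integration.integrable_bound[OF integrable_residual_bound])
  note [measurable] = residual_measurable[OF t]
  show "(\<lambda>\<omega>. (norm (v t \<omega>))\<^sup>2) \<in> borel_measurable M" by simp
  have "(norm (v t \<omega>))\<^sup>2 \<le> 2 * (\<Sum>t<T. (norm (e t \<omega>))\<^sup>2)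
      + (2 * L\<^sup>2 + 3 * L / \<eta>) * (\<Sum>t<T. (norm (d t \<omega>))\<^sup>2) + 2 / \<eta> * \<Delta>" if "\<omega> \<in> space M" for \<omega>
  proof -
    have "(norm (v t \<omega>))\<^sup>2 \<le> (\<Sum>t<T. (norm (v t \<omega>))\<^sup>2)"
      using t by (intro member_le_sum) auto
    then show ?thesis using sum_residuals_le[OF that] by linarith
  qed
  then show "AE \<omega> in M. norm ((norm (v t \<omega>))\<^sup>2) \<le> norm (2 * (\<Sum>t<T. (norm (e t \<omega>))\<^sup>2)
      + (2 * L\<^sup>2 + 3 * L / \<eta>) * (\<Sum>t<T. (norm (d t \<omega>))\<^sup>2) + 2 / \<eta> * \<Delta>)"
    by (intro AE_I2) (smt (verit) real_norm_def zero_le_power2)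
qed

text \<open>Eliminate the errors, then the moves. The doubled error sum raises
  \<open>2 * L\<^sup>2\<close> to the \<open>4 * L\<^sup>2\<close> of
  \<open>\<gamma>\<close>.\<close>

lemma sum_expected_residuals_le:
  fixes \<gamma> \<theta> :: real
  defines "\<gamma> \<equiv> 4 * L\<^sup>2 + 1 / \<eta>\<^sup>2 + 2 * L / \<eta>" and "\<theta> \<equiv> (1 - 3 * \<eta> * L) / (2 * \<eta>)"
  shows "(\<Sum>t<T. \<integral>\<omega>. (norm (v t \<omega>))\<^sup>2 \<partial>M)
    \<le> 2 * real T * refresh_variance + \<gamma> / \<theta> * (\<Delta> + real T * refresh_variance / (2 * L)) + 2 * \<Delta> / \<eta>"
proof -
  let ?E = "\<Sum>t<T. \<integral>\<omega>. (norm (e t \<omega>))\<^sup>2 \<partial>M" and ?D = "\<Sum>t<T. \<integral>\<omega>. (norm (d t \<omega>))\<^sup>2 \<partial>M"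
  have \<theta>: "\<theta> > 0" using \<eta> \<eta>L unfolding \<theta>_def by simp
  \<comment> \<open>Amounts to \<open>\<eta> * L \<le> 1\<close>: one of the three terms
    \<open>L / \<eta>\<close> is traded for the \<open>1 / \<eta>\<^sup>2\<close> in
    \<open>\<gamma>\<close>.\<close>
  have "3 * L / \<eta> \<le> 1 / \<eta>\<^sup>2 + 2 * L / \<eta>"
    using \<eta> \<eta>L by (simp add: field_simps power2_eq_square)
  then have \<gamma>: "4 * L\<^sup>2 + 3 * L / \<eta> \<le> \<gamma>" by (simp add: \<gamma>_def)
  have \<gamma>0: "0 \<le> \<gamma>" using \<eta> L_pos by (simp add: \<gamma>_def)
  have D0: "0 \<le> ?D" by (intro sum_nonneg integral_nonneg) auto
  have D: "?D \<le> (\<Delta> + real T * refresh_variance / (2 * L)) / \<theta>"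
    using sum_expected_moves_le \<theta> unfolding \<theta>_def[symmetric] by (simp add: pos_le_divide_eq mult.commute)
  have "(\<integral>\<omega>. (\<Sum>t<T. (norm (v t \<omega>))\<^sup>2) \<partial>M) \<le> (\<integral>\<omega>. 2 * (\<Sum>t<T. (norm (e t \<omega>))\<^sup>2)
      + (2 * L\<^sup>2 + 3 * L / \<eta>) * (\<Sum>t<T. (norm (d t \<omega>))\<^sup>2) + 2 / \<eta> * \<Delta> \<partial>M)"
    by (intro integral_mono integrable_residual_bound sum_residuals_le
        Bochner_Integration.integrable_sum integrable_residual) auto
  moreover have "(\<integral>\<omega>. 2 * (\<Sum>t<T. (norm (e t \<omega>))\<^sup>2)
      + (2 * L\<^sup>2 + 3 * L / \<eta>) * (\<Sum>t<T. (norm (d t \<omega>))\<^sup>2) + 2 / \<eta> * \<Delta> \<partial>M)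
      = 2 * ?E + (2 * L\<^sup>2 + 3 * L / \<eta>) * ?D + 2 / \<eta> * \<Delta>"
  proof -
    have "integrable M (\<lambda>\<omega>. 2 * (\<Sum>t<T. (norm (e t \<omega>))\<^sup>2))"
      "integrable M (\<lambda>\<omega>. (2 * L\<^sup>2 + 3 * L / \<eta>) * (\<Sum>t<T. (norm (d t \<omega>))\<^sup>2))"
      by (intro integrable_mult_right Bochner_Integration.integrable_sum integrable_error integrable_move; simp)+
    then show ?thesis
      by (simp add: integrable_error integrable_move run.prob_space)
  qed
  ultimately have "(\<Sum>t<T. \<integral>\<omega>. (norm (v t \<omega>))\<^sup>2 \<partial>M) \<le> 2 * ?E + (2 * L\<^sup>2 + 3 * L / \<eta>) * ?D + 2 / \<eta> * \<Delta>"
    by (simp add: integrable_residual)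
  also have "\<dots> \<le> 2 * (real T * refresh_variance + L\<^sup>2 * ?D) + (2 * L\<^sup>2 + 3 * L / \<eta>) * ?D + 2 / \<eta> * \<Delta>"
    using sum_expected_errors_le by (intro add_right_mono mult_left_mono) auto
  also have "\<dots> = 2 * real T * refresh_variance + (4 * L\<^sup>2 + 3 * L / \<eta>) * ?D + 2 * \<Delta> / \<eta>"
    by (simp add: algebra_simps)
  also have "\<dots> \<le> 2 * real T * refresh_variance
      + \<gamma> * ((\<Delta> + real T * refresh_variance / (2 * L)) / \<theta>) + 2 * \<Delta> / \<eta>"
    using D0 \<gamma>0 by (intro add_mono mult_mono \<gamma> D order_refl)
  finally show ?thesis by simp
qed

text \<open>Independence of \<open>R\<close> from the final history turns the expectation into an
  average over the fixed indices.\<close>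

lemma output_expectation:
  assumes W: "\<And>n. n \<in> {1..T} \<Longrightarrow> W n \<in> borel_measurable (HS T)"
  shows "(\<integral>\<^sup>+\<omega>. W (R \<omega>) (H T \<omega>) \<partial>M)
    = (\<Sum>n\<in>{1..T}. ennreal (1 / real T) * (\<integral>\<^sup>+\<omega>. W n (H T \<omega>) \<partial>M))"
proof -
  let ?U = "uniform_count_measure {1..T}"
  have T: "T > 0" by (rule run.params_pos)
  have R: "R \<in> measurable M ?U" and HT[measurable]: "H T \<in> measurable M (HS T)"
    using run.output_indep by (auto simp: run.indep_pair_def)
  interpret PH: prob_space "distr M (HS T) (H T)" by (rule run.prob_space_distr) (rule HT)
  \<comment> \<open>Joint measurability comes from the countable first component.\<close>
  have "(\<lambda>p. W (fst p) (snd p)) \<in> borel_measurable (count_space {1..T} \<Otimes>\<^sub>M HS T)"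
    by (rule measurable_pair_measure_countable1) (auto intro: W)
  moreover have sets: "sets (?U \<Otimes>\<^sub>M HS T) = sets (count_space {1..T} \<Otimes>\<^sub>M HS T)"
    by (intro sets_pair_measure_cong sets_uniform_count_measure_count_space refl)
  ultimately have Wm: "(\<lambda>p. W (fst p) (snd p)) \<in> borel_measurable (?U \<Otimes>\<^sub>M HS T)"
    by (simp cong: measurable_cong_sets)
  have "(\<integral>\<^sup>+\<omega>. W (R \<omega>) (H T \<omega>) \<partial>M)
      = (\<integral>\<^sup>+p. W (fst p) (snd p) \<partial>distr M (?U \<Otimes>\<^sub>M HS T) (\<lambda>\<omega>. (R \<omega>, H T \<omega>)))"
    by (subst nn_integral_distr[OF measurable_Pair[OF R HT]]) (simp_all only: measurable_distr_eq1 Wm fst_conv snd_conv)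
  also have "\<dots> = (\<integral>\<^sup>+p. W (fst p) (snd p) \<partial>(?U \<Otimes>\<^sub>M distr M (HS T) (H T)))"
    using run.distr_indep_pair[OF run.output_indep] run.output_law by simp
  also have "\<dots> = (\<integral>\<^sup>+n. \<integral>\<^sup>+h. W n h \<partial>distr M (HS T) (H T) \<partial>?U)"
    using PH.nn_integral_fst[of "\<lambda>p. W (fst p) (snd p)" ?U] Wm by (simp cong: measurable_cong_sets)
  also have "\<dots> = (\<Sum>n\<in>{1..T}. ennreal (1 / real T) * (\<integral>\<^sup>+h. W n h \<partial>distr M (HS T) (H T)))"
    unfolding uniform_count_measure_def by (subst nn_integral_point_measure_finite) auto
  also have "\<dots> = (\<Sum>n\<in>{1..T}. ennreal (1 / real T) * (\<integral>\<^sup>+\<omega>. W n (H T \<omega>) \<partial>M))"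
    by (intro sum.cong refl) (simp add: nn_integral_distr[OF HT] W)
  finally show ?thesis .
qed

text \<open>The residual of step \<open>t\<close> certifies the iterate with index
  \<open>Suc t\<close>, which is why the output index ranges over \<open>{1..T}\<close> and
  \<open>x 0\<close> is never returned.\<close>

lemma dist_zero_le_residual:
  assumes "t < T" "\<omega> \<in> space M"
  shows "dist_zero (frechet_subdiff (objective D f r) (x (Suc t) \<omega>)) \<le> ennreal (norm (v t \<omega>))"
proof -
  have "grad (x (Suc t) \<omega>) - g t \<omega> - (1 / \<eta>) *\<^sub>R (x (Suc t) \<omega> - x t \<omega>)
      \<in> frechet_subdiff (\<lambda>y. ereal (expected_loss D f y) + r y) (x (Suc t) \<omega>)"
    using assms
    by (intro prox_frechet_subgradient[OF problem.GDERIV_expected_loss problem.loss_smooth problem.r_proper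
          run.prox_step \<eta>])
  then have "v t \<omega> \<in> frechet_subdiff (objective D f r) (x (Suc t) \<omega>)"
    by (simp add: v_def d_def objective_def[abs_def])
  then show ?thesis unfolding dist_zero_def by (rule INF_lower)
qed

text \<open>Jensen's inequality is replaced by \<open>a \<le> \<epsilon> / 2 + a\<^sup>2 / (2 * \<epsilon>)\<close>.\<close>
lemma expected_stationarity_le:
  assumes \<epsilon>: "\<epsilon> > 0" and le: "(\<Sum>t<T. \<integral>\<omega>. (norm (v t \<omega>))\<^sup>2 \<partial>M) \<le> real T * \<epsilon>\<^sup>2"
  shows "expected_stationarity M (objective D f r) x R \<le> ennreal \<epsilon>"
proof -
  \<comment> \<open>The residual of step \<open>n - 1\<close> as a function of the history. Output
    indices are at least 1, so the subtraction never truncates.\<close>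
  define V where "V = (\<lambda>n h. grad (fst h n) - estimator (n - 1) h - (1 / \<eta>) *\<^sub>R (fst h n - fst h (n - 1)))"
  define W where "W = (\<lambda>n h. ennreal (\<epsilon> / 2 + (norm (V n h))\<^sup>2 / (2 * \<epsilon>)))"
  have T: "T > 0" by (rule run.params_pos)
  have V: "V (Suc t) (H T \<omega>) = v t \<omega>" if "t < T" "\<omega> \<in> space M" for t \<omega>
    using that by (simp add: V_def v_def d_def history_point estimator_history)
  have Wm: "W n \<in> borel_measurable (HS T)" if n: "n \<in> {1..T}" for n
  proof -
    have "V n \<in> borel_measurable (HS T)"
      unfolding V_def using n
      by (intro borel_measurable_diff borel_measurable_scaleR borel_measurable_const estimator_measurable
          measurable_compose[OF _ problem.grad_measurable] history_point_measurable) auto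
    then show ?thesis unfolding W_def by measurable
  qed
  have "expected_stationarity M (objective D f r) x R \<le> (\<integral>\<^sup>+\<omega>. W (R \<omega>) (H T \<omega>) \<partial>M)"
    unfolding expected_stationarity_def
  \<comment> \<open>Monotonicity is all that is asked of the distance as an integrand; from here on
    only the measurable majorant \<open>W\<close> is integrated.\<close>
  proof (rule nn_integral_mono)
    fix \<omega> assume \<omega>: "\<omega> \<in> space M"
    have "R \<in> measurable M (uniform_count_measure {1..T})"
      using run.output_indep by (simp add: run.indep_pair_def)
    from measurable_space[OF this \<omega>] have "R \<omega> \<in> {1..T}" by (simp add: space_uniform_count_measure)
    then obtain t where t: "R \<omega> = Suc t" "t < T" by (cases "R \<omega>") auto
    have "0 \<le> (\<epsilon> - norm (v t \<omega>))\<^sup>2 / (2 * \<epsilon>)" using \<epsilon> by simp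
    also have "\<dots> = \<epsilon> / 2 + (norm (v t \<omega>))\<^sup>2 / (2 * \<epsilon>) - norm (v t \<omega>)"
      using \<epsilon> by (simp add: field_simps power2_eq_square)
    finally have "ennreal (norm (v t \<omega>)) \<le> W (R \<omega>) (H T \<omega>)"
      using V[OF t(2) \<omega>] by (simp add: W_def t ennreal_leI)
    then show "dist_zero (frechet_subdiff (objective D f r) (x (R \<omega>) \<omega>)) \<le> W (R \<omega>) (H T \<omega>)"
      using dist_zero_le_residual[OF t(2) \<omega>] t(1) by simp
  qed
  also have "\<dots> = (\<Sum>n\<in>{1..T}. ennreal (1 / real T) * (\<integral>\<^sup>+\<omega>. W n (H T \<omega>) \<partial>M))"
    by (rule output_expectation[OF Wm])
  also have "\<dots> = (\<Sum>t<T. ennreal (1 / real T) * (\<integral>\<^sup>+\<omega>. W (Suc t) (H T \<omega>) \<partial>M))"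
    by (simp add: sum.atLeast1_atMost_eq)
  also have "\<dots> = (\<Sum>t<T. ennreal (1 / real T * (\<epsilon> / 2 + (\<integral>\<omega>. (norm (v t \<omega>))\<^sup>2 \<partial>M) / (2 * \<epsilon>))))"
  proof (rule sum.cong[OF refl])
    fix t assume "t \<in> {..<T}"
    then have t: "t < T" by simp
    have "(\<integral>\<^sup>+\<omega>. W (Suc t) (H T \<omega>) \<partial>M) = (\<integral>\<^sup>+\<omega>. ennreal (\<epsilon> / 2 + (norm (v t \<omega>))\<^sup>2 / (2 * \<epsilon>)) \<partial>M)"
      using t by (intro nn_integral_cong) (simp add: W_def V)
    also have "\<dots> = ennreal (\<integral>\<omega>. \<epsilon> / 2 + (norm (v t \<omega>))\<^sup>2 / (2 * \<epsilon>) \<partial>M)"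
      using \<epsilon> integrable_residual[OF t] by (intro nn_integral_eq_integral) auto
    also have "\<dots> = ennreal (\<epsilon> / 2 + (\<integral>\<omega>. (norm (v t \<omega>))\<^sup>2 \<partial>M) / (2 * \<epsilon>))"
      using integrable_residual[OF t] by (simp add: run.prob_space)
    finally have eq: "(\<integral>\<^sup>+\<omega>. W (Suc t) (H T \<omega>) \<partial>M)
        = ennreal (\<epsilon> / 2 + (\<integral>\<omega>. (norm (v t \<omega>))\<^sup>2 \<partial>M) / (2 * \<epsilon>))" .
    show "ennreal (1 / real T) * (\<integral>\<^sup>+\<omega>. W (Suc t) (H T \<omega>) \<partial>M)
        = ennreal (1 / real T * (\<epsilon> / 2 + (\<integral>\<omega>. (norm (v t \<omega>))\<^sup>2 \<partial>M) / (2 * \<epsilon>)))"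
      unfolding eq by (rule ennreal_mult'[symmetric]) simp
  qed
  also have "\<dots> = ennreal (\<Sum>t<T. 1 / real T * (\<epsilon> / 2 + (\<integral>\<omega>. (norm (v t \<omega>))\<^sup>2 \<partial>M) / (2 * \<epsilon>)))"
    using \<epsilon> by (intro sum_ennreal mult_nonneg_nonneg add_nonneg_nonneg divide_nonneg_pos integral_nonneg) auto
  also have "(\<Sum>t<T. 1 / real T * (\<epsilon> / 2 + (\<integral>\<omega>. (norm (v t \<omega>))\<^sup>2 \<partial>M) / (2 * \<epsilon>)))
      = \<epsilon> / 2 + (\<Sum>t<T. \<integral>\<omega>. (norm (v t \<omega>))\<^sup>2 \<partial>M) / (2 * \<epsilon> * real T)"
    using T \<epsilon> by (simp only: sum_distrib_left[symmetric] sum.distrib sum_divide_distrib[symmetric])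
      (simp add: field_simps)
  also have "\<dots> \<le> ennreal \<epsilon>"
  proof (rule ennreal_leI)
    have "(\<Sum>t<T. \<integral>\<omega>. (norm (v t \<omega>))\<^sup>2 \<partial>M) / (2 * \<epsilon> * real T) \<le> (real T * \<epsilon>\<^sup>2) / (2 * \<epsilon> * real T)"
      using le \<epsilon> by (intro divide_right_mono) auto
    also have "\<dots> = \<epsilon> / 2" using T \<epsilon> by (simp add: power2_eq_square)
    finally show "\<epsilon> / 2 + (\<Sum>t<T. \<integral>\<omega>. (norm (v t \<omega>))\<^sup>2 \<partial>M) / (2 * \<epsilon> * real T) \<le> \<epsilon>" by simp
  qed
  finally show ?thesis .
qed

end

section \<open>Sample complexity\<close>

lemma card_multiples_le:
  assumes "q > 0"
  shows "card {t \<in> {..<T}. q dvd t} \<le> nat \<lceil>real T / real q\<rceil>"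
proof -
  have "inj_on (\<lambda>t. t div q) {t \<in> {..<T}. q dvd t}"
    by (rule inj_onI) (auto simp: assms)
  moreover have "(\<lambda>t. t div q) ` {t \<in> {..<T}. q dvd t} \<subseteq> {..<nat \<lceil>real T / real q\<rceil>}"
  proof safe
    fix t assume t: "t < T" "q dvd t"
    have "real (t div q) = real t / real q" using t(2) by (simp add: real_of_nat_div)
    also have "\<dots> < real T / real q" using t(1) assms by (simp add: divide_strict_right_mono)
    finally show "t div q < nat \<lceil>real T / real q\<rceil>" by linarith
  qed
  ultimately have "card {t \<in> {..<T}. q dvd t} \<le> card {..<nat \<lceil>real T / real q\<rceil>}"
    by (intro card_inj_on_le) auto
  then show ?thesis by simp
qed

lemma samples_processed_le:
  assumes "q > 0"
  shows "samples_processed T q b1 b2 \<le> complexity_bound T q b1 b2"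
proof -
  \<comment> \<open>Refresh steps are charged \<open>b2\<close> as well, so that this part is simply
    \<open>b2\<close> at every step.\<close>
  have "samples_processed T q b1 b2 \<le> (\<Sum>t<T. (if q dvd t then b1 else 0) + b2)"
    unfolding samples_processed_def by (intro sum_mono) auto
  also have "\<dots> = b1 * card {t \<in> {..<T}. q dvd t} + b2 * T"
    by (simp add: sum.distrib flip: sum.inter_filter)
  also have "\<dots> \<le> complexity_bound T q b1 b2"
    unfolding complexity_bound_def using card_multiples_le[OF assms, of T] by simp
  finally show ?thesis .
qed

lemma real_nat_ceiling_le: "0 \<le> y \<Longrightarrow> real (nat \<lceil>y\<rceil>) \<le> y + 1"
  by linarith

text \<open>For \<open>N \<ge> 1\<close> rounding the root up at most doubles it, so the small
  batches cost at most \<open>2 * sqrt N * T\<close>. The refreshes cost at most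
  \<open>N * (T / sqrt N + 1)\<close>.\<close>

lemma complexity_bound_sqrt_le:
  assumes N: "N > 0"
  shows "real (complexity_bound T (nat \<lceil>sqrt (real N)\<rceil>) N (nat \<lceil>sqrt (real N)\<rceil>))
    \<le> 3 * sqrt (real N) * real T + real N"
proof -
  define Q where "Q = nat \<lceil>sqrt (real N)\<rceil>"
  have s1: "1 \<le> sqrt (real N)" using N by simp
  have Q1: "sqrt (real N) \<le> real Q" unfolding Q_def by linarith
  have Q0: "0 < real Q" using Q1 s1 by linarith
  have Q2: "real Q \<le> 2 * sqrt (real N)"
    using real_nat_ceiling_le[of "sqrt (real N)"] s1 unfolding Q_def by linarith
  have "real N * real (nat \<lceil>real T / real Q\<rceil>) \<le> real N * (real T / real Q + 1)"
    by (intro mult_left_mono real_nat_ceiling_le) auto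
  also have "\<dots> \<le> real N * (real T / sqrt (real N) + 1)"
    using Q1 Q0 N by (intro mult_left_mono add_right_mono divide_left_mono mult_pos_pos) auto
  also have "\<dots> = sqrt (real N) * real T + real N"
    using N by (simp add: distrib_left real_div_sqrt mult.commute flip: times_divide_eq_left)
  finally have "real N * real (nat \<lceil>real T / real Q\<rceil>) \<le> sqrt (real N) * real T + real N" .
  moreover have "real Q * real T \<le> 2 * sqrt (real N) * real T"
    using Q2 by (rule mult_right_mono) simp
  ultimately show ?thesis
    unfolding complexity_bound_def Q_def[symmetric] by (simp add: algebra_simps)
qed

lemma online_complexity_bigo:
  fixes A B :: real
  assumes A: "A > 0" and B: "B > 0"
    and N: "\<And>\<epsilon>. N \<epsilon> = nat \<lceil>A / \<epsilon>\<^sup>2\<rceil>" and Q: "\<And>\<epsilon>. Q \<epsilon> = nat \<lceil>sqrt (real (N \<epsilon>))\<rceil>"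
    and T: "\<And>\<epsilon>. T \<epsilon> = nat \<lceil>B / \<epsilon>\<^sup>2\<rceil>"
  shows "(\<lambda>\<epsilon>. real (complexity_bound (T \<epsilon>) (Q \<epsilon>) (N \<epsilon>) (Q \<epsilon>))) \<in> O[at_right 0](\<lambda>\<epsilon>. 1 / \<epsilon> ^ 3)"
proof (rule bigoI)
  \<comment> \<open>First summand: \<open>3 * sqrt N * T\<close> with \<open>N\<close> and
    \<open>T\<close> of order \<open>1 / \<epsilon>\<^sup>2\<close>. Second summand: the extra
    \<open>N\<close>, of lower order and enlarged to \<open>1 / \<epsilon> ^ 3\<close>.\<close>
  define C where "C = 3 * sqrt (A + 1) * (B + 1) + (A + 1)"
  have "norm (real (complexity_bound (T \<epsilon>) (Q \<epsilon>) (N \<epsilon>) (Q \<epsilon>))) \<le> C * norm (1 / \<epsilon> ^ 3)"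
    if \<epsilon>: "0 < \<epsilon>" "\<epsilon> < 1" for \<epsilon>
  proof -
    \<comment> \<open>For \<open>\<epsilon> < 1\<close> this absorbs the 1 that each rounding up may
      add.\<close>
    have e2: "1 \<le> 1 / \<epsilon>\<^sup>2" using \<epsilon> by (simp add: power_le_one)
    have "real (N \<epsilon>) \<le> A / \<epsilon>\<^sup>2 + 1" unfolding N using A by (intro real_nat_ceiling_le) auto
    then have N1: "real (N \<epsilon>) \<le> (A + 1) / \<epsilon>\<^sup>2" using e2 by (simp add: add_divide_distrib)
    have "real (T \<epsilon>) \<le> B / \<epsilon>\<^sup>2 + 1" unfolding T using B by (intro real_nat_ceiling_le) auto
    then have T1: "real (T \<epsilon>) \<le> (B + 1) / \<epsilon>\<^sup>2" using e2 by (simp add: add_divide_distrib)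
    have "sqrt (real (N \<epsilon>)) \<le> sqrt ((A + 1) / \<epsilon>\<^sup>2)" using N1 by (rule real_sqrt_le_mono)
    also have "\<dots> = sqrt (A + 1) / \<epsilon>" using \<epsilon> by (simp add: real_sqrt_divide)
    finally have sN: "sqrt (real (N \<epsilon>)) \<le> sqrt (A + 1) / \<epsilon>" .
    have "0 < A / \<epsilon>\<^sup>2" using A \<epsilon> by simp
    then have N0: "N \<epsilon> > 0" unfolding N by linarith
    have "real (complexity_bound (T \<epsilon>) (Q \<epsilon>) (N \<epsilon>) (Q \<epsilon>)) \<le> 3 * sqrt (real (N \<epsilon>)) * real (T \<epsilon>) + real (N \<epsilon>)"
      unfolding Q by (rule complexity_bound_sqrt_le[OF N0])
    also have "\<dots> \<le> 3 * (sqrt (A + 1) / \<epsilon>) * ((B + 1) / \<epsilon>\<^sup>2) + (A + 1) / \<epsilon>\<^sup>2"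
      using A \<epsilon> by (intro add_mono mult_mono sN T1 N1) auto
    also have "(A + 1) / \<epsilon>\<^sup>2 \<le> (A + 1) / \<epsilon> ^ 3"
      using A \<epsilon> by (intro divide_left_mono power_decreasing) auto
    also have "3 * (sqrt (A + 1) / \<epsilon>) * ((B + 1) / \<epsilon>\<^sup>2) + (A + 1) / \<epsilon> ^ 3 = C * (1 / \<epsilon> ^ 3)"
      using \<epsilon> by (simp add: C_def field_simps power2_eq_square power3_eq_cube)
    finally show ?thesis using \<epsilon> by simp
  qed
  then show "\<forall>\<^sub>F \<epsilon> in at_right 0. norm (real (complexity_bound (T \<epsilon>) (Q \<epsilon>) (N \<epsilon>) (Q \<epsilon>))) \<le> C * norm (1 / \<epsilon> ^ 3)"
    unfolding eventually_at_right_field by (intro exI[of _ 1]) auto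
qed

lemma finite_sum_complexity_le:
  fixes B \<epsilon> :: real
  assumes B: "B > 0" and n: "n > 0" and \<epsilon>: "\<epsilon> > 0"
  shows "real (complexity_bound (nat \<lceil>B / \<epsilon>\<^sup>2\<rceil>) (nat \<lceil>sqrt (real n)\<rceil>) n (nat \<lceil>sqrt (real n)\<rceil>))
    \<le> (3 * B + 4) * (sqrt (real n) / \<epsilon>\<^sup>2 + real n)"
proof -
  \<comment> \<open>Pays for the rounding of \<open>T\<close>, which may add
    \<open>3 * sqrt n\<close> however large \<open>\<epsilon>\<close> is; hence the bound is uniform
    in \<open>\<epsilon>\<close>.\<close>
  have s: "sqrt (real n) \<le> real n"
    using n by (simp add: real_sqrt_le_iff' power2_eq_square real_le_lsqrt)
  have "real (complexity_bound (nat \<lceil>B / \<epsilon>\<^sup>2\<rceil>) (nat \<lceil>sqrt (real n)\<rceil>) n (nat \<lceil>sqrt (real n)\<rceil>))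
      \<le> 3 * sqrt (real n) * real (nat \<lceil>B / \<epsilon>\<^sup>2\<rceil>) + real n"
    by (rule complexity_bound_sqrt_le[OF n])
  also have "\<dots> \<le> 3 * sqrt (real n) * (B / \<epsilon>\<^sup>2 + 1) + real n"
    using B by (intro add_right_mono mult_left_mono real_nat_ceiling_le) auto
  also have "\<dots> = 3 * B * (sqrt (real n) / \<epsilon>\<^sup>2) + 3 * sqrt (real n) + real n"
    by (simp add: algebra_simps)
  also have "\<dots> \<le> 3 * B * (sqrt (real n) / \<epsilon>\<^sup>2) + 4 * real n"
    using s by simp
  \<comment> \<open>Adding the missing nonnegative cross terms makes the bound a product.\<close>
  also have "\<dots> \<le> 3 * B * (sqrt (real n) / \<epsilon>\<^sup>2) + 4 * real n + (4 * (sqrt (real n) / \<epsilon>\<^sup>2) + 3 * B * real n)"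
    using B by simp
  also have "\<dots> = (3 * B + 4) * (sqrt (real n) / \<epsilon>\<^sup>2 + real n)"
    by (simp add: algebra_simps)
  finally show ?thesis .
qed

section \<open>Parameter choices in the two settings\<close>

theorem corollary4:
  fixes c L \<Delta> \<sigma> \<eta> \<gamma> \<theta> :: real
    and N1 Q1 T1 T2 :: "real \<Rightarrow> nat"
    and Q2 :: "nat \<Rightarrow> nat"
  assumes "0 < c" "c < 1 / 3" "L > 0" "\<Delta> > 0" "\<sigma> > 0"
    and "\<eta> = c / L"
    and "\<gamma> = 4 * L\<^sup>2 + 1 / \<eta>\<^sup>2 + 2 * L / \<eta>"
    and "\<theta> = (1 - 3 * \<eta> * L) / (2 * \<eta>)"
    and "\<And>\<epsilon>. N1 \<epsilon> = nat \<lceil>(\<gamma> + 4 * \<theta> * L) * \<sigma>\<^sup>2 / (\<theta> * L * \<epsilon>\<^sup>2)\<rceil>"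
    and "\<And>\<epsilon>. Q1 \<epsilon> = nat \<lceil>sqrt (real (N1 \<epsilon>))\<rceil>"
    and "\<And>\<epsilon>. T1 \<epsilon> = nat \<lceil>2 * (2 * \<theta> + \<gamma> * \<eta>) * \<Delta> / (\<eta> * \<theta> * \<epsilon>\<^sup>2)\<rceil>"
    and "\<And>n. Q2 n = nat \<lceil>sqrt (real n)\<rceil>"
    and "\<And>\<epsilon>. T2 \<epsilon> = nat \<lceil>(2 * \<theta> + \<gamma> * \<eta>) * \<Delta> / (\<eta> * \<theta> * \<epsilon>\<^sup>2)\<rceil>"
  shows
    "(\<forall>\<epsilon>>0. \<forall>(D :: 's measure) (f :: real ^ 'd \<Rightarrow> 's \<Rightarrow> real) r x0 (M :: 'w measure) \<xi> x g R.
        composite_problem D f r x0 L \<sigma> \<Delta> \<longrightarrow>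
        (\<forall>y. prox \<eta> r y \<noteq> {}) \<longrightarrow>
        spgr_run D f r x0 \<eta> Online (T1 \<epsilon>) (Q1 \<epsilon>) (N1 \<epsilon>) (Q1 \<epsilon>) M \<xi> x g R \<longrightarrow>
        expected_stationarity M (objective D f r) x R \<le> ennreal \<epsilon>)
   \<and> (\<forall>\<epsilon>>0. samples_processed (T1 \<epsilon>) (Q1 \<epsilon>) (N1 \<epsilon>) (Q1 \<epsilon>)
              \<le> complexity_bound (T1 \<epsilon>) (Q1 \<epsilon>) (N1 \<epsilon>) (Q1 \<epsilon>))
   \<and> (\<lambda>\<epsilon>. real (complexity_bound (T1 \<epsilon>) (Q1 \<epsilon>) (N1 \<epsilon>) (Q1 \<epsilon>))) \<in> O[at_right 0](\<lambda>\<epsilon>. 1 / \<epsilon> ^ 3)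
   \<and> (\<forall>\<epsilon>>0. \<forall>n\<ge>1. \<forall>(f :: real ^ 'd \<Rightarrow> nat \<Rightarrow> real) r x0 (M :: 'w measure) \<xi> x g R.
        composite_problem (uniform_count_measure {1..n}) f r x0 L \<sigma> \<Delta> \<longrightarrow>
        (\<forall>y. prox \<eta> r y \<noteq> {}) \<longrightarrow>
        spgr_run (uniform_count_measure {1..n}) f r x0 \<eta> Finite_Sum
          (T2 \<epsilon>) (Q2 n) n (Q2 n) M \<xi> x g R \<longrightarrow>
        expected_stationarity M (objective (uniform_count_measure {1..n}) f r) x R \<le> ennreal \<epsilon>)
   \<and> (\<forall>\<epsilon>>0. \<forall>n\<ge>1. samples_processed (T2 \<epsilon>) (Q2 n) n (Q2 n)
              \<le> complexity_bound (T2 \<epsilon>) (Q2 n) n (Q2 n))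
   \<and> (\<exists>C. \<forall>\<epsilon>>0. \<forall>n\<ge>1. real (complexity_bound (T2 \<epsilon>) (Q2 n) n (Q2 n))
              \<le> C * (sqrt (real n) / \<epsilon>\<^sup>2 + real n))"
proof (intro conjI)
  note c = assms(1,2) and L = assms(3) and \<Delta> = assms(4) and \<sigma> = assms(5) and \<eta>_eq = assms(6)
    and \<gamma>_eq = assms(7) and \<theta>_eq = assms(8) and N1 = assms(9) and Q1 = assms(10) and T1 = assms(11)
    and Q2 = assms(12) and T2 = assms(13)
  have \<eta>: "\<eta> > 0" and \<eta>L: "\<eta> * L < 1 / 3" using c L by (auto simp: \<eta>_eq)
  have \<theta>: "\<theta> > 0" using \<eta> \<eta>L by (simp add: \<theta>_eq)
  have \<gamma>: "\<gamma> > 0" using \<eta> L by (auto simp: \<gamma>_eq intro!: add_pos_pos)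
  define A where "A = (\<gamma> + 4 * \<theta> * L) * \<sigma>\<^sup>2 / (\<theta> * L)"
  define B where "B = (2 * \<theta> + \<gamma> * \<eta>) * \<Delta> / (\<eta> * \<theta>)"
  have A: "A > 0" and B: "B > 0"
    using \<theta> \<gamma> L \<sigma> \<eta> \<Delta> by (auto simp: A_def B_def intro!: divide_pos_pos mult_pos_pos add_pos_pos)
  have N1A: "N1 \<epsilon> = nat \<lceil>A / \<epsilon>\<^sup>2\<rceil>" for \<epsilon> by (simp add: N1 A_def)
  have T1B: "T1 \<epsilon> = nat \<lceil>2 * B / \<epsilon>\<^sup>2\<rceil>" for \<epsilon> by (simp only: T1 B_def mult.assoc divide_divide_eq_left times_divide_eq_right)
  have T2B: "T2 \<epsilon> = nat \<lceil>B / \<epsilon>\<^sup>2\<rceil>" for \<epsilon> by (simp add: T2 B_def)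
  have Q1_pos: "Q1 \<epsilon> > 0" if "\<epsilon> > 0" for \<epsilon>
  proof -
    have "0 < A / \<epsilon>\<^sup>2" using A that by simp
    then have "N1 \<epsilon> > 0" unfolding N1A by linarith
    then have "0 < sqrt (real (N1 \<epsilon>))" by simp
    then show ?thesis unfolding Q1 by linarith
  qed
  have Q2_pos: "Q2 n > 0" if "n \<ge> 1" for n
  proof -
    have "0 < sqrt (real n)" using that by simp
    then show ?thesis unfolding Q2 by linarith
  qed
  \<comment> \<open>\<open>B\<close> is the part of \<open>sum_expected_residuals_le\<close> that
    stems from the initial gap.\<close>
  have regroup: "\<gamma> / \<theta> * \<Delta> + 2 * \<Delta> / \<eta> = B"
    using \<theta> \<eta> by (simp add: B_def field_simps)
  show "\<forall>\<epsilon>>0. \<forall>(D :: 's measure) (f :: real ^ 'd \<Rightarrow> 's \<Rightarrow> real) r x0 (M :: 'w measure) \<xi> x g R.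
        composite_problem D f r x0 L \<sigma> \<Delta> \<longrightarrow>
        (\<forall>y. prox \<eta> r y \<noteq> {}) \<longrightarrow>
        spgr_run D f r x0 \<eta> Online (T1 \<epsilon>) (Q1 \<epsilon>) (N1 \<epsilon>) (Q1 \<epsilon>) M \<xi> x g R \<longrightarrow>
        expected_stationarity M (objective D f r) x R \<le> ennreal \<epsilon>"
  proof (intro allI impI)
    fix \<epsilon> :: real and D :: "'s measure" and f :: "real ^ 'd \<Rightarrow> 's \<Rightarrow> real" and r x0 and M :: "'w measure"
      and \<xi> x g R
    assume \<epsilon>: "0 < \<epsilon>" and problem: "composite_problem D f r x0 L \<sigma> \<Delta>"
      and run: "spgr_run D f r x0 \<eta> Online (T1 \<epsilon>) (Q1 \<epsilon>) (N1 \<epsilon>) (Q1 \<epsilon>) M \<xi> x g R"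
    interpret spgr_analysis D f r x0 L \<sigma> \<Delta> \<eta> Online "T1 \<epsilon>" "Q1 \<epsilon>" "N1 \<epsilon>" "Q1 \<epsilon>" M \<xi> x g R
      using problem run \<eta> \<eta>L by (intro spgr_analysis.intro spgr_analysis_axioms.intro) auto
    have N: "A / \<epsilon>\<^sup>2 \<le> real (N1 \<epsilon>)" unfolding N1A by linarith
    have "0 < A / \<epsilon>\<^sup>2" using A \<epsilon> by simp
    then have N0: "real (N1 \<epsilon>) > 0" using N by linarith
    have "A \<le> real (N1 \<epsilon>) * \<epsilon>\<^sup>2" using N \<epsilon> by (simp add: pos_divide_le_eq)
    then have "A / real (N1 \<epsilon>) \<le> \<epsilon>\<^sup>2" using N0 by (simp add: pos_divide_le_eq mult.commute)
    \<comment> \<open>\<open>A\<close> is chosen so that the variance contribution per step is half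
      of \<open>A / N1 \<epsilon>\<close>, hence at most
      \<open>\<epsilon>\<^sup>2 / 2\<close>.\<close>
    moreover have "2 * refresh_variance + \<gamma> / \<theta> * (refresh_variance / (2 * L)) = A / real (N1 \<epsilon>) / 2"
      unfolding refresh_variance_def A_def using \<theta> L N0 by (simp add: field_simps)
    ultimately have "2 * refresh_variance + \<gamma> / \<theta> * (refresh_variance / (2 * L)) \<le> \<epsilon>\<^sup>2 / 2" by simp
    then have "real (T1 \<epsilon>) * (2 * refresh_variance + \<gamma> / \<theta> * (refresh_variance / (2 * L)))
        \<le> real (T1 \<epsilon>) * (\<epsilon>\<^sup>2 / 2)"
      by (intro mult_left_mono) auto
    \<comment> \<open>The factor 2 in \<open>T1\<close> leaves the initial gap the other half of the
      budget.\<close>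
    moreover have "B \<le> real (T1 \<epsilon>) * (\<epsilon>\<^sup>2 / 2)"
    proof -
      have "2 * B / \<epsilon>\<^sup>2 \<le> real (T1 \<epsilon>)" unfolding T1B by linarith
      then show ?thesis using \<epsilon> by (simp add: pos_divide_le_eq)
    qed
    moreover have "(\<Sum>t<T1 \<epsilon>. \<integral>\<omega>. (norm (v t \<omega>))\<^sup>2 \<partial>M)
       \<le> real (T1 \<epsilon>) * (2 * refresh_variance + \<gamma> / \<theta> * (refresh_variance / (2 * L))) + B"
      using sum_expected_residuals_le unfolding \<gamma>_eq[symmetric] \<theta>_eq[symmetric] regroup[symmetric]
      by (simp add: algebra_simps)
    ultimately have "(\<Sum>t<T1 \<epsilon>. \<integral>\<omega>. (norm (v t \<omega>))\<^sup>2 \<partial>M) \<le> real (T1 \<epsilon>) * \<epsilon>\<^sup>2" by simp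
    then show "expected_stationarity M (objective D f r) x R \<le> ennreal \<epsilon>"
      by (rule expected_stationarity_le[OF \<epsilon>])
  qed
  show "\<forall>\<epsilon>>0. \<forall>n\<ge>1. \<forall>(f :: real ^ 'd \<Rightarrow> nat \<Rightarrow> real) r x0 (M :: 'w measure) \<xi> x g R.
        composite_problem (uniform_count_measure {1..n}) f r x0 L \<sigma> \<Delta> \<longrightarrow>
        (\<forall>y. prox \<eta> r y \<noteq> {}) \<longrightarrow>
        spgr_run (uniform_count_measure {1..n}) f r x0 \<eta> Finite_Sum
          (T2 \<epsilon>) (Q2 n) n (Q2 n) M \<xi> x g R \<longrightarrow>
        expected_stationarity M (objective (uniform_count_measure {1..n}) f r) x R \<le> ennreal \<epsilon>"
  proof (intro allI impI)
    fix \<epsilon> :: real and n :: nat and f :: "real ^ 'd \<Rightarrow> nat \<Rightarrow> real" and r x0 and M :: "'w measure"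
      and \<xi> x g R
    let ?D = "uniform_count_measure {1..n}"
    assume \<epsilon>: "0 < \<epsilon>" and problem: "composite_problem ?D f r x0 L \<sigma> \<Delta>"
      and run: "spgr_run ?D f r x0 \<eta> Finite_Sum (T2 \<epsilon>) (Q2 n) n (Q2 n) M \<xi> x g R"
    interpret spgr_analysis ?D f r x0 L \<sigma> \<Delta> \<eta> Finite_Sum "T2 \<epsilon>" "Q2 n" n "Q2 n" M \<xi> x g R
      using problem run \<eta> \<eta>L by (intro spgr_analysis.intro spgr_analysis_axioms.intro) auto
    \<comment> \<open>Exact refreshes have no variance, so the initial gap may use the whole budget
      and \<open>T2\<close> does without the factor 2.\<close>
    have "(\<Sum>t<T2 \<epsilon>. \<integral>\<omega>. (norm (v t \<omega>))\<^sup>2 \<partial>M) \<le> B"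
      using sum_expected_residuals_le unfolding \<gamma>_eq[symmetric] \<theta>_eq[symmetric] regroup[symmetric]
      by (simp add: refresh_variance_def)
    also have "B \<le> real (T2 \<epsilon>) * \<epsilon>\<^sup>2"
    proof -
      have "B / \<epsilon>\<^sup>2 \<le> real (T2 \<epsilon>)" unfolding T2B by linarith
      then show ?thesis using \<epsilon> by (simp add: pos_divide_le_eq)
    qed
    finally show "expected_stationarity M (objective ?D f r) x R \<le> ennreal \<epsilon>"
      by (rule expected_stationarity_le[OF \<epsilon>])
  qed
  show "\<forall>\<epsilon>>0. samples_processed (T1 \<epsilon>) (Q1 \<epsilon>) (N1 \<epsilon>) (Q1 \<epsilon>)
      \<le> complexity_bound (T1 \<epsilon>) (Q1 \<epsilon>) (N1 \<epsilon>) (Q1 \<epsilon>)"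
    by (simp add: samples_processed_le Q1_pos)
  show "\<forall>\<epsilon>>0. \<forall>n\<ge>1. samples_processed (T2 \<epsilon>) (Q2 n) n (Q2 n) \<le> complexity_bound (T2 \<epsilon>) (Q2 n) n (Q2 n)"
    using samples_processed_le Q2_pos by blast
  show "(\<lambda>\<epsilon>. real (complexity_bound (T1 \<epsilon>) (Q1 \<epsilon>) (N1 \<epsilon>) (Q1 \<epsilon>))) \<in> O[at_right 0](\<lambda>\<epsilon>. 1 / \<epsilon> ^ 3)"
    using A B by (intro online_complexity_bigo[OF _ _ N1A Q1 T1B]) auto
  show "\<exists>C. \<forall>\<epsilon>>0. \<forall>n\<ge>1. real (complexity_bound (T2 \<epsilon>) (Q2 n) n (Q2 n))
      \<le> C * (sqrt (real n) / \<epsilon>\<^sup>2 + real n)"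
    unfolding T2B Q2 using finite_sum_complexity_le[OF B] by (intro exI[of _ "3 * B + 4"]) auto
qed

end
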